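(* Let $k$ be a field of characteristic $p>0$, let $A=k[t]$, $R=A[x,y]$, and let $F=xy(x-y)(x-ty)\in R$. Let $R_F=R/(F)$ and $M_F=R_F/(x,y)R_F$. Then the sequence of modules $\{F^e_{R_F}(M_F)\}_{e>0}$ does not have finite torsion over $A$.
   Context: Here $t,x,y$ are indeterminates. For a Noetherian commutative ring $R'$ of characteristic $p$ and $q=p^e$, let $S$ be $R'$ viewed as an $R'$-algebra via the iterated Frobenius $r\mapsto r^q$; the Peskine–Szpiro functor is $F^e_{R'}(M)=S\otimes_{R'}M$, regarded as an $R'$-module through the left factor; in particular $F^e_{R'}(R'/I)=R'/I^{[q]}$, where $I^{[q]}$ is generated by the $q$-th powers of the elements of $I$ (so $F^e_{R_F}(M_F)=R_F/(x^q,y^q)R_F$). A sequence $\{M_n\}_n$ of modules over a domain $A$ has finite torsion (over $A$) if there exists a non-zero $a\in A$ such that $(M_n)_a$ is a torsion-free $A_a$-module for all $n$. *)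

theory Defs
  imports "HOL-Algebra.Algebra" "HOL-Algebra.Algebraic_Closure_Type"
    "HOL-Algebra.Free_Abelian_Groups"
begin

(* The module record extends the ring record, but the module locale never looks at
   the fields mult and one; they are left undefined. *)

definition mk_module ::
  "'b set \<Rightarrow> 'b \<Rightarrow> ('b \<Rightarrow> 'b \<Rightarrow> 'b) \<Rightarrow> ('a \<Rightarrow> 'b \<Rightarrow> 'b) \<Rightarrow> ('a, 'b) module" where
  "mk_module C z pl sm =
     \<lparr>carrier = C, monoid.mult = undefined, one = undefined, ring.zero = z,
      add = pl, module.smult = sm\<rparr>"

definition regular_module :: "('a, 'r) ring_scheme \<Rightarrow> ('a, 'a) module" where
  "regular_module R = mk_module (carrier R) \<zero>\<^bsub>R\<^esub> (\<lambda>x y. x \<oplus>\<^bsub>R\<^esub> y) (\<lambda>r x. r \<otimes>\<^bsub>R\<^esub> x)"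

(* The cyclic module R/I, on the same cosets as the quotient ring R Quot I. *)

definition quot_module :: "('a, 'r) ring_scheme \<Rightarrow> 'a set \<Rightarrow> ('a, 'a set) module" where
  "quot_module R I =
     mk_module (a_rcosets\<^bsub>R\<^esub> I) I (\<lambda>U V. U <+>\<^bsub>R\<^esub> V)
       (\<lambda>r U. \<Union>x\<in>U. I +>\<^bsub>R\<^esub> (r \<otimes>\<^bsub>R\<^esub> x))"

definition restrict_scalars :: "('a \<Rightarrow> 'b) \<Rightarrow> ('b, 'c, 'm) module_scheme \<Rightarrow> ('a, 'c) module" where
  "restrict_scalars f M =
     mk_module (carrier M) \<zero>\<^bsub>M\<^esub> (\<lambda>x y. x \<oplus>\<^bsub>M\<^esub> y) (\<lambda>a x. f a \<odot>\<^bsub>M\<^esub> x)"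


subsection \<open>Extension of scalars and the Peskine--Szpiro functor\<close>

(* Relators of the tensor product of S and M over R, where S is an R-algebra via phi. *)

definition tensor_relators ::
  "('a, 'r) ring_scheme \<Rightarrow> ('b, 's) ring_scheme \<Rightarrow> ('a \<Rightarrow> 'b) \<Rightarrow> ('a, 'c, 'm) module_scheme
     \<Rightarrow> ('b \<times> 'c \<Rightarrow>\<^sub>0 int) set" where
  "tensor_relators R S \<phi> M =
     {frag_of (s \<oplus>\<^bsub>S\<^esub> s', m) - frag_of (s, m) - frag_of (s', m) | s s' m.
        s \<in> carrier S \<and> s' \<in> carrier S \<and> m \<in> carrier M} \<union>
     {frag_of (s, m \<oplus>\<^bsub>M\<^esub> m') - frag_of (s, m) - frag_of (s, m') | s m m'.
        s \<in> carrier S \<and> m \<in> carrier M \<and> m' \<in> carrier M} \<union>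
     {frag_of (s \<otimes>\<^bsub>S\<^esub> \<phi> r, m) - frag_of (s, r \<odot>\<^bsub>M\<^esub> m) | s r m.
        s \<in> carrier S \<and> r \<in> carrier R \<and> m \<in> carrier M}"

definition tensor_subgroup ::
  "('a, 'r) ring_scheme \<Rightarrow> ('b, 's) ring_scheme \<Rightarrow> ('a \<Rightarrow> 'b) \<Rightarrow> ('a, 'c, 'm) module_scheme
     \<Rightarrow> ('b \<times> 'c \<Rightarrow>\<^sub>0 int) set" where
  "tensor_subgroup R S \<phi> M =
     generate (free_Abelian_group (carrier S \<times> carrier M)) (tensor_relators R S \<phi> M)"

(* The tensor product of S and M over R as an S-module through the left factor:
   the action of b on cosets is induced by (s, m) |-> (b s, m). *)

definition extend_scalars ::
  "('a, 'r) ring_scheme \<Rightarrow> ('b, 's) ring_scheme \<Rightarrow> ('a \<Rightarrow> 'b) \<Rightarrow> ('a, 'c, 'm) module_scheme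
     \<Rightarrow> ('b, ('b \<times> 'c \<Rightarrow>\<^sub>0 int) set) module" where
  "extend_scalars R S \<phi> M =
     (let G = free_Abelian_group (carrier S \<times> carrier M); H = tensor_subgroup R S \<phi> M
      in mk_module (rcosets\<^bsub>G\<^esub> H) H (\<lambda>U V. U <#>\<^bsub>G\<^esub> V)
           (\<lambda>b U. \<Union>c\<in>U. H #>\<^bsub>G\<^esub> frag_extend (\<lambda>(s, m). frag_of (b \<otimes>\<^bsub>S\<^esub> s, m)) c))"

definition peskine_szpiro ::
  "nat \<Rightarrow> nat \<Rightarrow> ('a, 'r) ring_scheme \<Rightarrow> ('a, 'c, 'm) module_scheme
     \<Rightarrow> ('a, ('a \<times> 'c \<Rightarrow>\<^sub>0 int) set) module" where
  "peskine_szpiro p e R M = extend_scalars R R (\<lambda>r. r [^]\<^bsub>R\<^esub> (p ^ e)) M"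


subsection \<open>Localization and finite torsion\<close>

definition powers :: "('a, 'r) ring_scheme \<Rightarrow> 'a \<Rightarrow> 'a set" where
  "powers R a = {a [^]\<^bsub>R\<^esub> n | n :: nat. True}"

definition frac_rel ::
  "('a, 'r) ring_scheme \<Rightarrow> 'a set \<Rightarrow> ('a, 'b, 'm) module_scheme \<Rightarrow> (('b \<times> 'a) \<times> ('b \<times> 'a)) set" where
  "frac_rel R S M =
     {((m, s), (m', s')). m \<in> carrier M \<and> s \<in> S \<and> m' \<in> carrier M \<and> s' \<in> S \<and>
        (\<exists>u\<in>S. u \<odot>\<^bsub>M\<^esub> (s' \<odot>\<^bsub>M\<^esub> m) = u \<odot>\<^bsub>M\<^esub> (s \<odot>\<^bsub>M\<^esub> m'))}"

definition fraction ::
  "('a, 'r) ring_scheme \<Rightarrow> 'a set \<Rightarrow> ('a, 'b, 'm) module_scheme \<Rightarrow> 'b \<Rightarrow> 'a \<Rightarrow> ('b \<times> 'a) set" where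
  "fraction R S M m s = frac_rel R S M `` {(m, s)}"

definition loc_ring :: "('a, 'r) ring_scheme \<Rightarrow> 'a set \<Rightarrow> ('a \<times> 'a) set ring" where
  "loc_ring R S =
     (let M = regular_module R in
      \<lparr>carrier = (carrier R \<times> S) // frac_rel R S M,
       monoid.mult = (\<lambda>U V. \<Union>(x, s)\<in>U. \<Union>(y, t)\<in>V. fraction R S M (x \<otimes>\<^bsub>R\<^esub> y) (s \<otimes>\<^bsub>R\<^esub> t)),
       one = fraction R S M \<one>\<^bsub>R\<^esub> \<one>\<^bsub>R\<^esub>,
       ring.zero = fraction R S M \<zero>\<^bsub>R\<^esub> \<one>\<^bsub>R\<^esub>,
       add = (\<lambda>U V. \<Union>(x, s)\<in>U. \<Union>(y, t)\<in>V.
                fraction R S M (t \<otimes>\<^bsub>R\<^esub> x \<oplus>\<^bsub>R\<^esub> s \<otimes>\<^bsub>R\<^esub> y) (s \<otimes>\<^bsub>R\<^esub> t))\<rparr>)"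

definition loc_module ::
  "('a, 'r) ring_scheme \<Rightarrow> 'a set \<Rightarrow> ('a, 'b, 'm) module_scheme
     \<Rightarrow> (('a \<times> 'a) set, ('b \<times> 'a) set) module" where
  "loc_module R S M =
     mk_module ((carrier M \<times> S) // frac_rel R S M) (fraction R S M \<zero>\<^bsub>M\<^esub> \<one>\<^bsub>R\<^esub>)
       (\<lambda>U V. \<Union>(x, s)\<in>U. \<Union>(y, t)\<in>V.
          fraction R S M (t \<odot>\<^bsub>M\<^esub> x \<oplus>\<^bsub>M\<^esub> s \<odot>\<^bsub>M\<^esub> y) (s \<otimes>\<^bsub>R\<^esub> t))
       (\<lambda>Z U. \<Union>(r, t)\<in>Z. \<Union>(x, s)\<in>U. fraction R S M (r \<odot>\<^bsub>M\<^esub> x) (t \<otimes>\<^bsub>R\<^esub> s))"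

(* Only used over domains, where "regular" and "non-zero" agree. *)

definition torsion_free :: "('a, 'r) ring_scheme \<Rightarrow> ('a, 'b, 'm) module_scheme \<Rightarrow> bool" where
  "torsion_free A M \<longleftrightarrow>
     (\<forall>a\<in>carrier A. \<forall>m\<in>carrier M. a \<odot>\<^bsub>M\<^esub> m = \<zero>\<^bsub>M\<^esub> \<longrightarrow> a = \<zero>\<^bsub>A\<^esub> \<or> m = \<zero>\<^bsub>M\<^esub>)"

definition finite_torsion ::
  "('a, 'r) ring_scheme \<Rightarrow> 'i set \<Rightarrow> ('i \<Rightarrow> ('a, 'b, 'm) module_scheme) \<Rightarrow> bool" where
  "finite_torsion A I M \<longleftrightarrow>
     (\<exists>a\<in>carrier A. a \<noteq> \<zero>\<^bsub>A\<^esub> \<and>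
        (\<forall>n\<in>I. torsion_free (loc_ring A (powers A a)) (loc_module A (powers A a) (M n))))"


subsection \<open>The rings and the module of the example\<close>

(* k[t] is 'k poly, and k[t][x,y] is the iterated polynomial ring k[t][x][y]:
   x is the middle variable and y the outermost one. *)

type_synonym 'k txy = "'k poly poly poly"

definition ring_A :: "'k::field poly ring" where
  "ring_A = ring_of_type_algebra"

definition ring_R :: "'k::field txy ring" where
  "ring_R = ring_of_type_algebra"

definition const_A :: "'k::field poly \<Rightarrow> 'k txy" where
  "const_A a = [:[:a:]:]"

definition t_R :: "'k::field txy" where
  "t_R = const_A [:0, 1:]"

definition x_R :: "'k::field txy" where
  "x_R = [:[:0, 1:]:]"

definition y_R :: "'k::field txy" where
  "y_R = [:0, 1:]"

definition poly_F :: "'k::field txy" where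
  "poly_F = x_R * y_R * (x_R - y_R) * (x_R - t_R * y_R)"

definition ideal_F :: "'k::field txy set" where
  "ideal_F = PIdl\<^bsub>ring_R\<^esub> poly_F"

definition ring_RF :: "'k::field txy set ring" where
  "ring_RF = ring_R Quot ideal_F"

definition to_RF :: "'k::field txy \<Rightarrow> 'k txy set" where
  "to_RF r = ideal_F +>\<^bsub>ring_R\<^esub> r"

definition module_MF :: "('k::field txy set, 'k txy set set) module" where
  "module_MF = quot_module ring_RF (Idl\<^bsub>ring_RF\<^esub> {to_RF x_R, to_RF y_R})"

end

theory Submission
  imports Defs
begin

text \<open>Put \<open>q = p^e\<close> and \<open>J = (F, x^q, y^q)\<close>, so that \<open>R/J\<close> is the \<open>e\<close>-th module of the sequence.
  The element \<open>w = x^2 y^(q-1)\<close> is torsion modulo \<open>J\<close>: multiples of \<open>F\<close> give a three-term recursion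
  between the monomials of degree \<open>q + 1\<close>, hence \<open>(t - 1) x^(k+1) y^(q-k) \<equiv> (t^k - 1) w\<close>, and the left
  side lies in \<open>J\<close> for \<open>k = q - 1\<close>.

  Conversely let \<open>c w \<in> J\<close> with \<open>c \<in> k[t]\<close>. Substituting \<open>(x, y) = (uz, vz)\<close> for the four zeros
  \<open>(u, v) = (1, 0), (0, 1), (1, 1), (t, 1)\<close> of \<open>F\<close> and comparing coefficients of \<open>z^(q+1)\<close> shows that
  \<open>t^q - t\<close> divides \<open>c (t^2 - t)\<close>. This fails for \<open>c = a^n\<close> once \<open>q > deg a + 2\<close>: for a large power
  \<open>Q\<close> of \<open>q\<close>, the polynomial \<open>a^Q\<close> is congruent modulo \<open>t^q - t\<close> to the polynomial obtained from \<open>a\<close>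
  by raising the coefficients to the power \<open>Q\<close>, which has the same degree as \<open>a\<close>.\<close>

subsection \<open>The ideal of the four lines and the Frobenius powers\<close>

text \<open>The combinations are explicit because the annihilator argument reads off coefficients of
  the cofactors \<open>\<beta>\<close> and \<open>\<gamma>\<close>.\<close>

definition katzman_ideal :: "'a::comm_ring_1 \<Rightarrow> 'a \<Rightarrow> 'a \<Rightarrow> nat \<Rightarrow> 'a set" where
  "katzman_ideal f x y q = {\<alpha> * f + \<beta> * x ^ q + \<gamma> * y ^ q | \<alpha> \<beta> \<gamma>. True}"

lemma katzman_ideal_iff:
  "z \<in> katzman_ideal f x y q \<longleftrightarrow> (\<exists>\<alpha> \<beta> \<gamma>. z = \<alpha> * f + \<beta> * x ^ q + \<gamma> * y ^ q)"
  by (simp add: katzman_ideal_def)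

lemma katzman_ideal_0 [simp]: "0 \<in> katzman_ideal f x y q"
  unfolding katzman_ideal_iff by (rule exI[of _ 0])+ simp

lemma katzman_ideal_add:
  assumes "a \<in> katzman_ideal f x y q" "b \<in> katzman_ideal f x y q"
  shows "a + b \<in> katzman_ideal f x y q"
proof -
  obtain a1 a2 a3 b1 b2 b3 where
    "a = a1 * f + a2 * x ^ q + a3 * y ^ q" "b = b1 * f + b2 * x ^ q + b3 * y ^ q"
    using assms by (auto simp: katzman_ideal_iff)
  then have "a + b = (a1 + b1) * f + (a2 + b2) * x ^ q + (a3 + b3) * y ^ q"
    by (simp add: algebra_simps)
  then show ?thesis unfolding katzman_ideal_iff by blast
qed

lemma katzman_ideal_mult:
  assumes "a \<in> katzman_ideal f x y q"
  shows "c * a \<in> katzman_ideal f x y q"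
proof -
  obtain a1 a2 a3 where "a = a1 * f + a2 * x ^ q + a3 * y ^ q"
    using assms by (auto simp: katzman_ideal_iff)
  then have "c * a = (c * a1) * f + (c * a2) * x ^ q + (c * a3) * y ^ q"
    by (simp add: algebra_simps)
  then show ?thesis unfolding katzman_ideal_iff by blast
qed

lemma katzman_ideal_diff:
  assumes "a \<in> katzman_ideal f x y q" "b \<in> katzman_ideal f x y q"
  shows "a - b \<in> katzman_ideal f x y q"
  using katzman_ideal_add[OF assms(1) katzman_ideal_mult[OF assms(2), of "- 1"]] by simp

lemma katzman_ideal_f: "f dvd a \<Longrightarrow> a \<in> katzman_ideal f x y q"
proof -
  assume "f dvd a"
  then obtain c where "a = c * f + 0 * x ^ q + 0 * y ^ q"
    by (auto simp: dvd_def mult.commute)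
  then show ?thesis unfolding katzman_ideal_iff by blast
qed

lemma katzman_ideal_powers: "b * x ^ q + c * y ^ q \<in> katzman_ideal f x y q"
proof -
  have "b * x ^ q + c * y ^ q = 0 * f + b * x ^ q + c * y ^ q" by simp
  then show ?thesis unfolding katzman_ideal_iff by blast
qed

section \<open>A torsion element from a linear recursion\<close>

text \<open>Put \<open>v_i = x^(i+1) y^(q-i)\<close>. Suitable monomial multiples of
  \<open>f\<close> have the form \<open>v_(j+2) - (1+t) v_(j+1) + t v_j\<close>, a recursion with
  characteristic polynomial \<open>(s-1)(s-t)\<close>. Modulo the ideal its start values are
  \<open>v_0 = 0\<close> and \<open>v_1 = w\<close>, which suggests
  \<open>v_k = (t^k-1)/(t-1) w\<close>; the statement clears the denominator.\<close>

lemma four_lines_torsion_aux: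
  fixes x y t :: "'a::comm_ring_1"
  defines "f \<equiv> x * y * (x - y) * (x - t * y)"
  assumes "k < q"
  shows "(t - 1) * (x ^ (k + 1) * y ^ (q - k)) - (t ^ k - 1) * (x ^ 2 * y ^ (q - 1))
           \<in> katzman_ideal f x y q"
  using assms(2)
proof (induction k rule: less_induct)
  case (less k)
  consider "k = 0" | "k = 1" | j where "k = Suc (Suc j)"
    by (metis One_nat_def not0_implies_Suc)
  then show ?case
  proof cases
    case 1
    then show ?thesis
      using katzman_ideal_powers[of 0 x q "(t - 1) * x" y f] by (simp add: algebra_simps)
  next
    case 2
    then show ?thesis by (simp add: power2_eq_square)
  next
    case 3
    \<comment> \<open>One factor \<open>y\<close> of \<open>v k\<close> is absorbed by
      \<open>f\<close>, leaving \<open>y^r\<close>; this uses \<open>k < q\<close>.\<close>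
    define r where "r = q - k - 1"
    have q: "q = k + 1 + r"
      using less.prems by (simp add: r_def)
    define v where "v i = x ^ (i + 1) * y ^ (q - i)" for i
    define J where "J = katzman_ideal f x y q"
    define w where "w = x ^ 2 * y ^ (q - 1)"
    have IH: "(t - 1) * v i - (t ^ i - 1) * w \<in> J" if "i < k" for i
      using less.IH[OF that] that less.prems by (simp add: v_def w_def J_def)
    have v: "v k = x ^ j * (x ^ 3 * (y * y ^ r))" "v (Suc j) = x ^ j * (x ^ 2 * (y ^ 2 * y ^ r))"
         "v j = x ^ j * (x * (y ^ 3 * y ^ r))"
      unfolding v_def using q 3 by (simp_all add: power_add eval_nat_numeral algebra_simps)
    have eq: "v k - (1 + t) * v (Suc j) + t * v j = x ^ j * y ^ r * f"
      unfolding v f_def by (simp add: eval_nat_numeral algebra_simps)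
    \<comment> \<open>The terms in \<open>w\<close> match because
      \<open>(1+t)(t^(k-1)-1) - t(t^(k-2)-1) = t^k-1\<close>.\<close>
    have "(t - 1) * v k - (t ^ k - 1) * w =
        (t - 1) * (v k - (1 + t) * v (Suc j) + t * v j)
        + (1 + t) * ((t - 1) * v (Suc j) - (t ^ Suc j - 1) * w)
        - t * ((t - 1) * v j - (t ^ j - 1) * w)"
      by (simp add: 3 algebra_simps)
    also have "\<dots> \<in> J"
      unfolding J_def eq
      by (intro katzman_ideal_add katzman_ideal_diff katzman_ideal_mult katzman_ideal_f dvd_triv_right
          IH[unfolded J_def]) (simp_all add: 3)
    finally show ?thesis by (simp add: v_def w_def J_def)
  qed
qed

text \<open>The case \<open>k = q - 1\<close> of the recursion, where the monomial
  \<open>x^q y\<close> itself lies in the ideal.\<close>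

lemma four_lines_torsion:
  fixes x y t :: "'a::comm_ring_1"
  assumes "q > 0"
  shows "(t ^ (q - 1) - 1) * (x ^ 2 * y ^ (q - 1)) \<in> katzman_ideal (x * y * (x - y) * (x - t * y)) x y q"
proof -
  let ?J = "katzman_ideal (x * y * (x - y) * (x - t * y)) x y q"
  have "(t - 1) * (x ^ q * y) - (t ^ (q - 1) - 1) * (x ^ 2 * y ^ (q - 1)) \<in> ?J"
    using four_lines_torsion_aux[of "q - 1" q t x y] assms by simp
  moreover have "(t - 1) * (x ^ q * y) \<in> ?J"
    using katzman_ideal_powers[of "(t - 1) * y" x q 0 y] by (simp add: algebra_simps)
  ultimately show ?thesis
    using katzman_ideal_diff by fastforce
qed

section \<open>Restriction to lines through the origin\<close>

text \<open>Restriction to the line \<open>z |-> (uz, vz)\<close>: composition treats the inner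
  variable \<open>x\<close>, outer evaluation treats \<open>y\<close>. It is a ring homomorphism
  that kills \<open>f\<close> when \<open>(u, v)\<close> is a zero of \<open>f\<close>.\<close>

definition line_subst :: "'a::comm_ring_1 \<Rightarrow> 'a \<Rightarrow> 'a poly poly \<Rightarrow> 'a poly" where
  "line_subst u v P = poly (map_poly (\<lambda>f. f \<circ>\<^sub>p [:0, u:]) P) [:0, v:]"

lemma line_subst_add: "line_subst u v (P + Q) = line_subst u v P + line_subst u v Q"
proof -
  have "map_poly (\<lambda>f. f \<circ>\<^sub>p [:0, u:]) (P + Q) =
      map_poly (\<lambda>f. f \<circ>\<^sub>p [:0, u:]) P + map_poly (\<lambda>f. f \<circ>\<^sub>p [:0, u:]) Q"
    by (rule poly_eqI) (simp add: coeff_map_poly pcompose_add)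
  then show ?thesis by (simp add: line_subst_def)
qed

lemma line_subst_mult: "line_subst u v (P * Q) = line_subst u v P * line_subst u v Q"
proof -
  have "map_poly (\<lambda>f. f \<circ>\<^sub>p [:0, u:]) (P * Q) =
      map_poly (\<lambda>f. f \<circ>\<^sub>p [:0, u:]) P * map_poly (\<lambda>f. f \<circ>\<^sub>p [:0, u:]) Q"
    by (rule poly_eqI) (simp add: coeff_map_poly coeff_mult pcompose_sum pcompose_mult)
  then show ?thesis by (simp add: line_subst_def)
qed

lemma line_subst_const [simp]: "line_subst u v [:[:a:]:] = [:a:]"
  by (simp add: line_subst_def map_poly_pCons)

lemma line_subst_1 [simp]: "line_subst u v 1 = 1"
  using line_subst_const[of u v 1] by (simp add: one_pCons)

lemma line_subst_power: "line_subst u v (P ^ n) = line_subst u v P ^ n"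
  by (induction n) (simp_all add: line_subst_mult)

lemma line_subst_x [simp]: "line_subst u v [:[:0, 1:]:] = [:0, u:]"
  by (simp add: line_subst_def map_poly_pCons pcompose_pCons)

lemma line_subst_y [simp]: "line_subst u v [:0, 1:] = [:0, v:]"
  by (simp add: line_subst_def map_poly_pCons pcompose_1)

lemma line_subst_diff: "line_subst u v (P - Q) = line_subst u v P - line_subst u v Q"
  using line_subst_add[of u v "P - Q" Q] by simp

text \<open>In degree \<open>q + 1\<close>, a multiple of \<open>x^q\<close> or \<open>y^q\<close>
  sees only the linear part of its cofactor, so these coefficients are all that the comparison below
  requires.\<close>

lemma coeff_1_line_subst:
  "coeff (line_subst u v P) 1 = u * coeff (coeff P 0) 1 + v * coeff (coeff P 1) 0"
proof -
  obtain f g h where P: "P = pCons f (pCons g h)" by (metis pCons_cases)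
  obtain a b c d k where f: "f = pCons a (pCons b c)" and g: "g = pCons d k" by (metis pCons_cases)
  show ?thesis
    by (simp add: P f g line_subst_def map_poly_pCons pcompose_pCons algebra_simps)
qed

lemma linear_power: "[:0, u:] ^ n = monom (u ^ n) n" for u :: "'a::comm_ring_1"
  by (induction n) (simp_all add: one_pCons monom_0 monom_Suc smult_monom)

text \<open>On each of the four lines the cofactor of \<open>f\<close> disappears. The degree
  \<open>q + 1\<close> coefficients then give four linear equations in the linear coefficients of
  the other two cofactors, and elimination leaves one multiple of \<open>t^q - t\<close>.\<close>

lemma four_lines_annihilator:
  fixes a t :: "'a::idom"
  defines "x \<equiv> [:[:0, 1:]:]" and "y \<equiv> [:0, 1:]"
  assumes "q > 1" 
    and J: "[:[:a:]:] * (x ^ 2 * y ^ (q - 1))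
       \<in> katzman_ideal (x * y * (x - y) * (x - [:[:t:]:] * y)) x y q"
  shows "(t ^ q - t) dvd a * (t ^ 2 - t)"
proof -
  obtain \<alpha> \<beta> \<gamma> where eq: "[:[:a:]:] * (x ^ 2 * y ^ (q - 1)) =
      \<alpha> * (x * y * (x - y) * (x - [:[:t:]:] * y)) + \<beta> * x ^ q + \<gamma> * y ^ q"
    using J by (auto simp: katzman_ideal_iff)
  \<comment> \<open>The coefficients of \<open>x\<close> and \<open>y\<close> in
    \<open>\<beta>\<close>, then those in \<open>\<gamma>\<close>; the inner index counts powers of
    \<open>x\<close>.\<close>
  define b1 b2 c1 c2 where "b1 = coeff (coeff \<beta> 0) 1" "b2 = coeff (coeff \<beta> 1) 0"
    "c1 = coeff (coeff \<gamma> 0) 1" "c2 = coeff (coeff \<gamma> 1) 0"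
  note b = this
  have key: "a * (u ^ 2 * v ^ (q - 1)) = u ^ q * (u * b1 + v * b2) + v ^ q * (u * c1 + v * c2)"
    if root: "u * v * (u - v) * (u - t * v) = 0" for u v
  proof -
    have xy: "line_subst u v x = [:0, u:]" "line_subst u v y = [:0, v:]"
      by (simp_all only: x_def y_def line_subst_x line_subst_y)
    have "[:0, u:] * [:0, v:] * ([:0, u:] - [:0, v:]) * ([:0, u:] - [:t:] * [:0, v:]) = 0"
      using root by auto
    then have "[:a:] * (monom (u ^ 2) 2 * monom (v ^ (q - 1)) (q - 1)) =
       line_subst u v \<beta> * monom (u ^ q) q + line_subst u v \<gamma> * monom (v ^ q) q"
      using arg_cong[OF eq, of "line_subst u v"]
      by (simp only: line_subst_mult line_subst_add line_subst_diff line_subst_power line_subst_const xy linear_power) simp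
    then have "coeff ([:a:] * (monom (u ^ 2) 2 * monom (v ^ (q - 1)) (q - 1))) (q + 1) =
       coeff (monom (u ^ q) q * line_subst u v \<beta> + monom (v ^ q) q * line_subst u v \<gamma>) (q + 1)"
      by (simp add: mult.commute)
    then show ?thesis
      using \<open>q > 1\<close>
      by (simp add: mult_monom coeff_monom_mult b coeff_1_line_subst[unfolded One_nat_def])
  qed
  \<comment> \<open>On the two axes the left side vanishes; at \<open>(1, 0)\<close> this is
    \<open>0^(q-1) = 0\<close>, which rests on \<open>q > 1\<close>.\<close>
  have "b1 = 0" using key[of 1 0] \<open>q > 1\<close> by (simp add: power_0_left)
  moreover have "c2 = 0" using key[of 0 1] \<open>q > 1\<close> by (simp add: power_0_left)
  moreover have "a = b1 + b2 + c1 + c2" using key[of 1 1] by simp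
  moreover have "a * t ^ 2 = t ^ q * (t * b1 + b2) + t * c1 + c2" using key[of t 1] by simp
  \<comment> \<open>What remains is \<open>a = b2 + c1\<close> and
    \<open>a t^2 = t^q b2 + t c1\<close>; subtracting \<open>t\<close> times the first equation
    removes \<open>c1\<close>.\<close>
  ultimately have "a * (t ^ 2 - t) = (t ^ q - t) * b2"
    by (simp add: algebra_simps)
  then show ?thesis by simp
qed

section \<open>Powers modulo \<open>t^q - t\<close>\<close>

text \<open>Modulo \<open>z^q - z\<close> the element \<open>z\<close> is fixed by the
  \<open>q\<close>-th power, hence by all its iterates.\<close>

lemma dvd_power_iterate:
  fixes z :: "'a::comm_ring_1"
  shows "(z ^ q - z) dvd (z ^ (q ^ m) - z)"
proof (induction m)
  case (Suc m)
  have "(z ^ (q ^ m) - z) dvd ((z ^ (q ^ m)) ^ q - z ^ q)"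
    by (simp only: power_diff_sumr2 dvd_triv_left)
  then have "(z ^ q - z) dvd ((z ^ (q ^ m)) ^ q - z ^ q) + (z ^ q - z)"
    using Suc.IH by (meson dvd_add dvd_refl dvd_trans)
  then show ?case by (simp add: mult.commute flip: power_mult)
qed auto

text \<open>Raising to the power \<open>q^m\<close> is additive in characteristic \<open>p\<close>,
  twists the coefficients, and sends \<open>t\<close> to \<open>t^(q^m)\<close>, which is congruent
  to \<open>t\<close>. The coefficients come from an arbitrary field, so they need not be fixed by
  the twist.\<close>

lemma dvd_power_minus_map_poly:
  fixes a :: "'k::field poly"
  assumes "Factorial_Ring.prime CHAR('k)" and q: "q = CHAR('k) ^ e"
  shows "([:0, 1:] ^ q - [:0, 1:]) dvd (a ^ (q ^ m) - map_poly (\<lambda>c. c ^ (q ^ m)) a)"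
proof (induction a)
  case 0
  then show ?case
    using assms prime_gt_0_nat by (simp add: power_0_left)
next
  case (pCons c a)
  define z :: "'k poly" where "z = [:0, 1:]"
  define Q where "Q = q ^ m"
  \<comment> \<open>Then \<open>0^Q = 0\<close>, so that mapping the coefficients is compatible with
    \<open>pCons\<close>.\<close>
  have "Q > 0" using assms prime_gt_0_nat by (simp add: Q_def)
  have "pCons c a = [:c:] + z * a" by (simp add: z_def)
  also have "\<dots> ^ Q = [:c:] ^ Q + (z * a) ^ Q"
    by (rule freshmans_dream') (use assms in \<open>simp_all add: Q_def flip: power_mult\<close>)
  finally have 1: "pCons c a ^ Q = [:c ^ Q:] + z ^ Q * a ^ Q"
    by (simp add: power_mult_distrib poly_const_pow)
  have 2: "map_poly (\<lambda>c. c ^ Q) (pCons c a) = [:c ^ Q:] + z * map_poly (\<lambda>c. c ^ Q) a"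
    using \<open>Q > 0\<close> by (simp add: z_def map_poly_pCons)
  have 3: "(z ^ q - z) dvd (z ^ Q - z) * a ^ Q + z * (a ^ Q - map_poly (\<lambda>c. c ^ Q) a)"
    using dvd_power_iterate[of z q m] pCons.IH
    by (intro dvd_add dvd_mult dvd_mult2) (simp_all add: z_def Q_def)
  have 4: "pCons c a ^ Q - map_poly (\<lambda>c. c ^ Q) (pCons c a) = 
     (z ^ Q - z) * a ^ Q + z * (a ^ Q - map_poly (\<lambda>c. c ^ Q) a)"
    unfolding 1 2 by (simp add: algebra_simps)
  show ?case
    using 3 unfolding 4[symmetric] by (simp add: z_def Q_def)
qed

text \<open>The degree bound does not depend on \<open>n\<close>: modulo \<open>t^q - t\<close> a
  high power of \<open>a\<close> can be replaced by a polynomial of the same degree as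
  \<open>a\<close>, and the product with \<open>b\<close> is then nonzero of degree below
  \<open>q\<close>.\<close>

lemma not_dvd_power_mult:
  fixes a b :: "'k::field poly"
  assumes char: "Factorial_Ring.prime CHAR('k)" and q: "q = CHAR('k) ^ e" "e > 0"
    and nz: "a \<noteq> 0" "b \<noteq> 0" and deg: "degree a + degree b < q"
  shows "\<not> ([:0, 1:] ^ q - [:0, 1:]) dvd a ^ n * b"
proof
  define z :: "'k poly" where "z = [:0, 1:]"
  assume "([:0, 1:] ^ q - [:0, 1:]) dvd a ^ n * b"
  then have dvd: "(z ^ q - z) dvd a ^ n * b" by (simp add: z_def)
  have "CHAR('k) > 1" using char prime_gt_1_nat by blast
  then have "q > 1" using q one_less_power by blast
  \<comment> \<open>A power of \<open>q\<close> that is at least \<open>n\<close>, so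
    \<open>a^n\<close> divides \<open>a^Q\<close>.\<close>
  define Q where "Q = q ^ n"
  have "n \<le> Q"
    using \<open>q > 1\<close> by (simp add: Q_def less_imp_le)
  have "Q > 0" using \<open>q > 1\<close> by (simp add: Q_def)
  define a' where "a' = map_poly (\<lambda>c. c ^ Q) a"
  have "a ^ n * b dvd a ^ Q * b"
    using \<open>n \<le> Q\<close> by (intro mult_dvd_mono le_imp_power_dvd) auto
  with dvd have "(z ^ q - z) dvd a ^ Q * b" by (rule dvd_trans)
  moreover have "(z ^ q - z) dvd (a ^ Q - a') * b"
    using dvd_power_minus_map_poly[OF char q(1), of a n] by (simp add: z_def Q_def a'_def)
  ultimately have "(z ^ q - z) dvd a ^ Q * b - (a ^ Q - a') * b"
    by (rule dvd_diff)
  then have "(z ^ q - z) dvd a' * b" by (simp add: algebra_simps)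
  moreover have "degree a' = degree a"
    unfolding a'_def using \<open>a \<noteq> 0\<close> \<open>Q > 0\<close> by (subst map_poly_degree_eq) auto
  moreover have "a' \<noteq> 0"
    unfolding a'_def using \<open>a \<noteq> 0\<close> \<open>Q > 0\<close> by (subst map_poly_eq_0_iff) auto
  moreover have "degree (z ^ q - z) = q"
    using \<open>q > 1\<close> degree_add_eq_left[of "- z" "z ^ q"]
    by (simp add: z_def degree_power_eq diff_conv_add_uminus del: add_uminus_conv_diff)
  ultimately show False
    using deg nz dvd_imp_degree_le[of "z ^ q - z" "a' * b"] by (simp add: degree_mult_eq)
qed

subsection \<open>Localization\<close>

text \<open>Torsion and localization at a multiplicative set involve only the multiplicative half of the
  module axioms.\<close>

locale scalar_action = cring R for R :: "('a, 'r) ring_scheme" (structure) +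
  fixes M :: "('a, 'b, 'm) module_scheme"
  assumes smult_closed: "\<lbrakk>a \<in> carrier R; m \<in> carrier M\<rbrakk> \<Longrightarrow> a \<odot>\<^bsub>M\<^esub> m \<in> carrier M"
    and smult_assoc: "\<lbrakk>a \<in> carrier R; b \<in> carrier R; m \<in> carrier M\<rbrakk> 
          \<Longrightarrow> (a \<otimes> b) \<odot>\<^bsub>M\<^esub> m = a \<odot>\<^bsub>M\<^esub> (b \<odot>\<^bsub>M\<^esub> m)"
    and smult_one: "m \<in> carrier M \<Longrightarrow> \<one> \<odot>\<^bsub>M\<^esub> m = m"
    and zero_mem: "\<zero>\<^bsub>M\<^esub> \<in> carrier M"
    and smult_zero: "a \<in> carrier R \<Longrightarrow> a \<odot>\<^bsub>M\<^esub> \<zero>\<^bsub>M\<^esub> = \<zero>\<^bsub>M\<^esub>"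
begin

lemma smult_left_commute:
  "\<lbrakk>a \<in> carrier R; b \<in> carrier R; m \<in> carrier M\<rbrakk> \<Longrightarrow> a \<odot>\<^bsub>M\<^esub> (b \<odot>\<^bsub>M\<^esub> m) = b \<odot>\<^bsub>M\<^esub> (a \<odot>\<^bsub>M\<^esub> m)"
  using m_comm by (simp flip: smult_assoc)

end

lemma regular_module_simps:
  "carrier (regular_module R) = carrier R" "a \<odot>\<^bsub>regular_module R\<^esub> b = a \<otimes>\<^bsub>R\<^esub> b"
  by (simp_all add: regular_module_def mk_module_def)

lemma (in cring) scalar_action_regular_module: "scalar_action R (regular_module R)"
  by unfold_locales (auto simp: regular_module_def mk_module_def m_assoc)

locale localized_action = scalar_action +
  fixes S
  assumes S_subset: "S \<subseteq> carrier R"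
    and S_one: "\<one> \<in> S"
    and S_mult: "\<lbrakk>s \<in> S; t \<in> S\<rbrakk> \<Longrightarrow> s \<otimes> t \<in> S"
begin

lemma S_carrier: "s \<in> S \<Longrightarrow> s \<in> carrier R"
  using S_subset by auto

lemma equiv_frac_rel: "equiv (carrier M \<times> S) (frac_rel R S M)"
proof (rule equivI)
  show "frac_rel R S M \<subseteq> (carrier M \<times> S) \<times> (carrier M \<times> S)"
    by (auto simp: frac_rel_def)
  show "refl_on (carrier M \<times> S) (frac_rel R S M)"
    using S_one by (auto simp: refl_on_def frac_rel_def)
  show "sym (frac_rel R S M)"
    by (auto simp: sym_def frac_rel_def) metis
  show "trans (frac_rel R S M)"
  proof (rule transI, clarsimp simp: frac_rel_def)
    fix m s m' s' m'' s'' u v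
    assume mem: "m \<in> carrier M" "s \<in> S" "m' \<in> carrier M" "s' \<in> S" "m'' \<in> carrier M" "s'' \<in> S"
      "u \<in> S" "v \<in> S"
      and u: "u \<odot>\<^bsub>M\<^esub> (s' \<odot>\<^bsub>M\<^esub> m) = u \<odot>\<^bsub>M\<^esub> (s \<odot>\<^bsub>M\<^esub> m')"
      and v: "v \<odot>\<^bsub>M\<^esub> (s'' \<odot>\<^bsub>M\<^esub> m') = v \<odot>\<^bsub>M\<^esub> (s' \<odot>\<^bsub>M\<^esub> m'')"
    note carr = mem S_carrier[OF mem(2)] S_carrier[OF mem(4)] S_carrier[OF mem(6)]
      S_carrier[OF mem(7)] S_carrier[OF mem(8)] smult_closed
    \<comment> \<open>Scalars cannot be cancelled in \<open>M\<close>, so the middle denominator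
      \<open>s'\<close> has to enter the witness.\<close>
    have "(u \<otimes> v \<otimes> s') \<odot>\<^bsub>M\<^esub> (s'' \<odot>\<^bsub>M\<^esub> m) = v \<odot>\<^bsub>M\<^esub> (s'' \<odot>\<^bsub>M\<^esub> (u \<odot>\<^bsub>M\<^esub> (s' \<odot>\<^bsub>M\<^esub> m)))"
      using carr by (simp add: smult_assoc smult_left_commute)
    also have "\<dots> = u \<odot>\<^bsub>M\<^esub> (s \<odot>\<^bsub>M\<^esub> (v \<odot>\<^bsub>M\<^esub> (s'' \<odot>\<^bsub>M\<^esub> m')))"
      unfolding u using carr by (simp add: smult_left_commute)
    also have "\<dots> = (u \<otimes> v \<otimes> s') \<odot>\<^bsub>M\<^esub> (s \<odot>\<^bsub>M\<^esub> m'')"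
      unfolding v using carr by (simp add: smult_assoc smult_left_commute)
    finally show "\<exists>w\<in>S. w \<odot>\<^bsub>M\<^esub> (s'' \<odot>\<^bsub>M\<^esub> m) = w \<odot>\<^bsub>M\<^esub> (s \<odot>\<^bsub>M\<^esub> m'')"
      using mem S_mult by blast
  qed
qed

lemma fraction_eq_iff:
  assumes "m \<in> carrier M" "s \<in> S" "m' \<in> carrier M" "s' \<in> S"
  shows "fraction R S M m s = fraction R S M m' s' \<longleftrightarrow>
    (\<exists>u\<in>S. u \<odot>\<^bsub>M\<^esub> (s' \<odot>\<^bsub>M\<^esub> m) = u \<odot>\<^bsub>M\<^esub> (s \<odot>\<^bsub>M\<^esub> m'))"
proof -
  have "fraction R S M m s = fraction R S M m' s' \<longleftrightarrow> ((m, s), (m', s')) \<in> frac_rel R S M"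
    unfolding fraction_def using assms by (intro eq_equiv_class_iff[OF equiv_frac_rel]) auto
  also have "\<dots> \<longleftrightarrow> (\<exists>u\<in>S. u \<odot>\<^bsub>M\<^esub> (s' \<odot>\<^bsub>M\<^esub> m) = u \<odot>\<^bsub>M\<^esub> (s \<odot>\<^bsub>M\<^esub> m'))"
    using assms by (simp add: frac_rel_def)
  finally show ?thesis .
qed

lemma fraction_self: "\<lbrakk>m \<in> carrier M; s \<in> S\<rbrakk> \<Longrightarrow> (m, s) \<in> fraction R S M m s"
  unfolding fraction_def by (rule equiv_class_self[OF equiv_frac_rel]) auto

lemma mem_fraction:
  "(m', s') \<in> fraction R S M m s \<Longrightarrow> m' \<in> carrier M \<and> s' \<in> S \<and> m \<in> carrier M \<and> s \<in> S \<and>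
     (\<exists>u\<in>S. u \<odot>\<^bsub>M\<^esub> (s' \<odot>\<^bsub>M\<^esub> m) = u \<odot>\<^bsub>M\<^esub> (s \<odot>\<^bsub>M\<^esub> m'))"
  by (auto simp: fraction_def frac_rel_def)

lemma fraction_mem_loc_module:
  "\<lbrakk>m \<in> carrier M; s \<in> S\<rbrakk> \<Longrightarrow> fraction R S M m s \<in> carrier (loc_module R S M)"
  by (auto simp: loc_module_def mk_module_def fraction_def intro: quotientI)

lemma zero_loc_module: "\<zero>\<^bsub>loc_module R S M\<^esub> = fraction R S M \<zero>\<^bsub>M\<^esub> \<one>"
  by (simp add: loc_module_def mk_module_def)

text \<open>The product is a union over all pairs of representatives. Each pair yields the same
  class, with witness \<open>u v\<close> built from the two given witnesses, so the union
  collapses.\<close>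

lemma fraction_smult:
  assumes r: "r \<in> carrier R" "t \<in> S" and x: "x \<in> carrier M" "s \<in> S"
  shows "fraction R S (regular_module R) r t \<odot>\<^bsub>loc_module R S M\<^esub> fraction R S M x s
       = fraction R S M (r \<odot>\<^bsub>M\<^esub> x) (t \<otimes> s)"
proof -
  interpret reg: scalar_action R "regular_module R" by (rule scalar_action_regular_module)
  interpret reg: localized_action R "regular_module R" S
    by unfold_locales (auto simp: S_subset S_one S_mult)
  note reg = regular_module_simps
  have eq: "fraction R S M (r' \<odot>\<^bsub>M\<^esub> x') (t' \<otimes> s') = fraction R S M (r \<odot>\<^bsub>M\<^esub> x) (t \<otimes> s)"
    if r': "(r', t') \<in> fraction R S (regular_module R) r t" and x': "(x', s') \<in> fraction R S M x s"
    for r' t' x' s'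
  proof -
    from reg.mem_fraction[OF r'] obtain u where u: "r' \<in> carrier R" "t' \<in> S" "u \<in> S"
      "u \<otimes> (t' \<otimes> r) = u \<otimes> (t \<otimes> r')" by (auto simp: reg)
    from mem_fraction[OF x'] obtain v where v: "x' \<in> carrier M" "s' \<in> S" "v \<in> S"
      "v \<odot>\<^bsub>M\<^esub> (s' \<odot>\<^bsub>M\<^esub> x) = v \<odot>\<^bsub>M\<^esub> (s \<odot>\<^bsub>M\<^esub> x')" by auto
    note carr = u(1-3) v(1-3) r x S_carrier[OF u(2)] S_carrier[OF u(3)] S_carrier[OF v(2)]
      S_carrier[OF v(3)] S_carrier[OF r(2)] S_carrier[OF x(2)] smult_closed S_mult
    have "(u \<otimes> v) \<odot>\<^bsub>M\<^esub> ((t \<otimes> s) \<odot>\<^bsub>M\<^esub> (r' \<odot>\<^bsub>M\<^esub> x')) = (u \<otimes> (t \<otimes> r')) \<odot>\<^bsub>M\<^esub> (v \<odot>\<^bsub>M\<^esub> (s \<odot>\<^bsub>M\<^esub> x'))"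
      using carr by (simp add: smult_assoc smult_left_commute)
    also have "\<dots> = (u \<otimes> v) \<odot>\<^bsub>M\<^esub> ((t' \<otimes> s') \<odot>\<^bsub>M\<^esub> (r \<odot>\<^bsub>M\<^esub> x))"
      unfolding u(4)[symmetric] v(4)[symmetric] using carr by (simp add: smult_assoc smult_left_commute)
    finally show ?thesis
      using carr by (subst fraction_eq_iff) auto
  qed
  have "fraction R S (regular_module R) r t \<odot>\<^bsub>loc_module R S M\<^esub> fraction R S M x s =
     (\<Union>(r', t')\<in>fraction R S (regular_module R) r t. \<Union>(x', s')\<in>fraction R S M x s.
        fraction R S M (r' \<odot>\<^bsub>M\<^esub> x') (t' \<otimes> s'))"
    by (simp add: loc_module_def mk_module_def)
  also have "\<dots> = (\<Union>_\<in>fraction R S (regular_module R) r t. \<Union>_\<in>fraction R S M x s.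
        fraction R S M (r \<odot>\<^bsub>M\<^esub> x) (t \<otimes> s))"
    using eq by (intro SUP_cong) (auto split: prod.splits)
  also have "\<dots> = fraction R S M (r \<odot>\<^bsub>M\<^esub> x) (t \<otimes> s)"
    using fraction_self[OF x] reg.fraction_self[of r t] r by (auto simp: reg)
  finally show ?thesis .
qed

end

text \<open>Over a domain \<open>b/1\<close> stays nonzero in the localization at \<open>a\<close>.
  It kills \<open>m/1\<close>, so torsion-freeness forces \<open>m/1 = 0\<close>, which means that a
  power of \<open>a\<close> kills \<open>m\<close>.\<close>

lemma torsion_free_localizationD:
  assumes act: "scalar_action A M" and dom: "domain A" and a: "a \<in> carrier A" "a \<noteq> \<zero>\<^bsub>A\<^esub>"
    and tf: "torsion_free (loc_ring A (powers A a)) (loc_module A (powers A a) M)"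
    and b: "b \<in> carrier A" "b \<noteq> \<zero>\<^bsub>A\<^esub>" and m: "m \<in> carrier M" and bm: "b \<odot>\<^bsub>M\<^esub> m = \<zero>\<^bsub>M\<^esub>"
  shows "\<exists>n::nat. (a [^]\<^bsub>A\<^esub> n) \<odot>\<^bsub>M\<^esub> m = \<zero>\<^bsub>M\<^esub>"
proof -
  define S where "S = powers A a"
  interpret domain A by (rule dom)
  interpret M: scalar_action A M by (rule act)
  interpret reg: scalar_action A "regular_module A" by (rule scalar_action_regular_module)
  have pow: "a [^]\<^bsub>A\<^esub> n \<otimes>\<^bsub>A\<^esub> a [^]\<^bsub>A\<^esub> k = a [^]\<^bsub>A\<^esub> (n + k)" for n k :: nat
    using a by (simp add: nat_pow_mult)
  have S: "S \<subseteq> carrier A" "\<one>\<^bsub>A\<^esub> \<in> S" "\<lbrakk>s \<in> S; t \<in> S\<rbrakk> \<Longrightarrow> s \<otimes>\<^bsub>A\<^esub> t \<in> S" for s t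
    using a by (auto simp: S_def powers_def pow intro: exI[of _ "0::nat"])
  interpret M: localized_action A M S by unfold_locales (auto simp: S)
  interpret reg: localized_action A "regular_module A" S by unfold_locales (auto simp: S)
  note reg = regular_module_simps
  have nz: "s \<noteq> \<zero>\<^bsub>A\<^esub>" if "s \<in> S" for s
  proof -
    have "a [^]\<^bsub>A\<^esub> n \<noteq> \<zero>\<^bsub>A\<^esub>" for n :: nat
      by (induction n) (use a integral in auto)
    then show ?thesis using that by (auto simp: S_def powers_def)
  qed
  define b' m' where "b' = fraction A S (regular_module A) b \<one>\<^bsub>A\<^esub>" "m' = fraction A S M m \<one>\<^bsub>A\<^esub>"
  note defs = this
  have "b' \<in> carrier (loc_ring A S)"
    using b S by (auto simp: defs loc_ring_def fraction_def reg Let_def intro: quotientI)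
  moreover have "m' \<in> carrier (loc_module A S M)"
    unfolding defs using m S by (intro M.fraction_mem_loc_module)
  moreover have "b' \<odot>\<^bsub>loc_module A S M\<^esub> m' = \<zero>\<^bsub>loc_module A S M\<^esub>"
    unfolding defs using b m S by (simp add: M.fraction_smult M.zero_loc_module bm)
  moreover have "b' \<noteq> \<zero>\<^bsub>loc_ring A S\<^esub>"
  proof
    assume "b' = \<zero>\<^bsub>loc_ring A S\<^esub>"
    then have "fraction A S (regular_module A) b \<one>\<^bsub>A\<^esub> = fraction A S (regular_module A) \<zero>\<^bsub>A\<^esub> \<one>\<^bsub>A\<^esub>"
      by (simp add: defs loc_ring_def Let_def)
    then obtain u where "u \<in> S" "u \<otimes>\<^bsub>A\<^esub> (\<one>\<^bsub>A\<^esub> \<otimes>\<^bsub>A\<^esub> b) = u \<otimes>\<^bsub>A\<^esub> (\<one>\<^bsub>A\<^esub> \<otimes>\<^bsub>A\<^esub> \<zero>\<^bsub>A\<^esub>)"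
      using b S by (subst (asm) reg.fraction_eq_iff) (auto simp: reg)
    then show False
      using nz b S(1) integral by fastforce
  qed
  ultimately have "m' = \<zero>\<^bsub>loc_module A S M\<^esub>"
    using tf by (auto simp: torsion_free_def S_def)
  then have "fraction A S M m \<one>\<^bsub>A\<^esub> = fraction A S M \<zero>\<^bsub>M\<^esub> \<one>\<^bsub>A\<^esub>"
    by (simp add: defs M.zero_loc_module)
  then obtain u where "u \<in> S" "u \<odot>\<^bsub>M\<^esub> (\<one>\<^bsub>A\<^esub> \<odot>\<^bsub>M\<^esub> m) = u \<odot>\<^bsub>M\<^esub> (\<one>\<^bsub>A\<^esub> \<odot>\<^bsub>M\<^esub> \<zero>\<^bsub>M\<^esub>)"
    using m S M.zero_mem by (subst (asm) M.fraction_eq_iff) auto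
  then have "u \<odot>\<^bsub>M\<^esub> m = \<zero>\<^bsub>M\<^esub>"
    using m M.zero_mem M.S_carrier M.smult_zero by (simp add: M.smult_one)
  then show ?thesis
    using \<open>u \<in> S\<close> by (auto simp: S_def powers_def)
qed

lemma scalar_action_restrict_scalars:
  assumes "scalar_action R M" "cring A" and f: "f \<in> ring_hom A R"
  shows "scalar_action A (restrict_scalars f M)"
proof -
  interpret M: scalar_action R M by fact
  interpret A: cring A by fact
  show ?thesis
    by unfold_locales
      (use f in \<open>auto simp: restrict_scalars_def mk_module_def ring_hom_closed ring_hom_mult ring_hom_one
         M.smult_closed M.smult_assoc M.smult_one M.zero_mem M.smult_zero\<close>)
qed

subsection \<open>Extension of scalars\<close>

text \<open>The closure conditions place all relators in the free abelian group on pairs of carrier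
  elements.\<close>

locale tensor = S: cring S for R :: "('a, 'r) ring_scheme" and S :: "('b, 's) ring_scheme" +
  fixes \<phi> :: "'a \<Rightarrow> 'b" and M :: "('a, 'c, 'm) module_scheme"
  assumes phi_closed: "r \<in> carrier R \<Longrightarrow> \<phi> r \<in> carrier S"
    and M_add_closed: "\<lbrakk>m \<in> carrier M; m' \<in> carrier M\<rbrakk> \<Longrightarrow> m \<oplus>\<^bsub>M\<^esub> m' \<in> carrier M"
    and M_smult_closed: "\<lbrakk>r \<in> carrier R; m \<in> carrier M\<rbrakk> \<Longrightarrow> r \<odot>\<^bsub>M\<^esub> m \<in> carrier M"
begin

abbreviation "F \<equiv> free_Abelian_group (carrier S \<times> carrier M)"
abbreviation "H \<equiv> tensor_subgroup R S \<phi> M"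

definition scale :: "'b \<Rightarrow> ('b \<times> 'c \<Rightarrow>\<^sub>0 int) \<Rightarrow> ('b \<times> 'c \<Rightarrow>\<^sub>0 int)" where
  "scale b = frag_extend (\<lambda>(s, m). frag_of (b \<otimes>\<^bsub>S\<^esub> s, m))"

text \<open>The elementary tensor of \<open>s\<close> and \<open>m\<close>.\<close>

definition pure :: "'b \<Rightarrow> 'c \<Rightarrow> ('b \<times> 'c \<Rightarrow>\<^sub>0 int) set" where
  "pure s m = H #>\<^bsub>F\<^esub> frag_of (s, m)"

lemma tensor_relatorI:
  "\<lbrakk>s \<in> carrier S; s' \<in> carrier S; m \<in> carrier M\<rbrakk>
     \<Longrightarrow> frag_of (s \<oplus>\<^bsub>S\<^esub> s', m) - frag_of (s, m) - frag_of (s', m) \<in> tensor_relators R S \<phi> M"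
  "\<lbrakk>s \<in> carrier S; m \<in> carrier M; m' \<in> carrier M\<rbrakk>
     \<Longrightarrow> frag_of (s, m \<oplus>\<^bsub>M\<^esub> m') - frag_of (s, m) - frag_of (s, m') \<in> tensor_relators R S \<phi> M"
  "\<lbrakk>s \<in> carrier S; r \<in> carrier R; m \<in> carrier M\<rbrakk>
     \<Longrightarrow> frag_of (s \<otimes>\<^bsub>S\<^esub> \<phi> r, m) - frag_of (s, r \<odot>\<^bsub>M\<^esub> m) \<in> tensor_relators R S \<phi> M"
  unfolding tensor_relators_def
    apply (rule UnI1, rule UnI1, rule CollectI, intro exI conjI, rule refl; assumption)
   apply (rule UnI1, rule UnI2, rule CollectI, intro exI conjI, rule refl; assumption)
  apply (rule UnI2, rule CollectI, intro exI conjI, rule refl; assumption)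
  done

lemma tensor_relatorE [consumes 1, case_names left right scalar]:
  assumes "c \<in> tensor_relators R S \<phi> M"
  obtains s s' m where "s \<in> carrier S" "s' \<in> carrier S" "m \<in> carrier M"
      "c = frag_of (s \<oplus>\<^bsub>S\<^esub> s', m) - frag_of (s, m) - frag_of (s', m)"
    | s m m' where "s \<in> carrier S" "m \<in> carrier M" "m' \<in> carrier M"
      "c = frag_of (s, m \<oplus>\<^bsub>M\<^esub> m') - frag_of (s, m) - frag_of (s, m')"
    | s r m where "s \<in> carrier S" "r \<in> carrier R" "m \<in> carrier M"
      "c = frag_of (s \<otimes>\<^bsub>S\<^esub> \<phi> r, m) - frag_of (s, r \<odot>\<^bsub>M\<^esub> m)"
  using assms unfolding tensor_relators_def
  apply (elim UnE CollectE exE conjE)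
    apply (rule that(1); assumption)
   apply (rule that(2); assumption)
  apply (rule that(3); assumption)
  done

lemma keys_frag_diff2: "Poly_Mapping.keys (frag_of a - frag_of b) \<subseteq> {a, b}"
  using keys_diff[of "frag_of a" "frag_of b"] by (auto simp: keys_frag_of)

lemma keys_frag_diff3: "Poly_Mapping.keys (frag_of a - frag_of b - frag_of c) \<subseteq> {a, b, c}"
  using keys_diff[of "frag_of a - frag_of b" "frag_of c"] keys_frag_diff2[of a b]
  by (auto simp: keys_frag_of)

lemma tensor_relators_subset: "tensor_relators R S \<phi> M \<subseteq> carrier F"
proof
  fix c assume "c \<in> tensor_relators R S \<phi> M"
  then show "c \<in> carrier F"
    by (cases rule: tensor_relatorE)
      (auto dest!: subsetD[OF keys_frag_diff2] subsetD[OF keys_frag_diff3]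
       simp: phi_closed M_add_closed M_smult_closed)
qed

lemma subgroup_H: "subgroup H F"
  unfolding tensor_subgroup_def
  by (rule group.generate_is_subgroup[OF group_free_Abelian_group tensor_relators_subset])

lemma H_carrier: "c \<in> H \<Longrightarrow> Poly_Mapping.keys c \<subseteq> carrier S \<times> carrier M"
  using subgroup.mem_carrier[OF subgroup_H] by auto

lemma H_0: "0 \<in> H"
  using subgroup.one_closed[OF subgroup_H] by simp

lemma H_add: "\<lbrakk>c \<in> H; d \<in> H\<rbrakk> \<Longrightarrow> c + d \<in> H"
  using subgroup.m_closed[OF subgroup_H] by fastforce

lemma H_minus: "c \<in> H \<Longrightarrow> - c \<in> H"
  using subgroup.m_inv_closed[OF subgroup_H] H_carrier by fastforce

lemma H_diff: "\<lbrakk>c \<in> H; d \<in> H\<rbrakk> \<Longrightarrow> c - d \<in> H"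
  using H_add[of c "- d"] H_minus[of d] by simp

lemma relator_in_H: "c \<in> tensor_relators R S \<phi> M \<Longrightarrow> c \<in> H"
  unfolding tensor_subgroup_def by (rule generate.incl)

text \<open>Differences cover both group operations of \<open>generate\<close>: \<open>-h\<close> is
  \<open>0 - h\<close>, and a sum is \<open>h1 - (0 - h2)\<close>.\<close>

lemma H_induct [consumes 1, case_names zero diff relator]:
  assumes "c \<in> H" and "P 0" 
    and diff: "\<And>c d. \<lbrakk>c \<in> H; d \<in> H; P c; P d\<rbrakk> \<Longrightarrow> P (c - d)"
    and rel: "\<And>c. c \<in> tensor_relators R S \<phi> M \<Longrightarrow> P c"
  shows "P c"
  using assms(1) unfolding tensor_subgroup_def
proof (induction rule: generate.induct)
  case one
  then show ?case using assms by simp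
next
  case (incl h)
  then show ?case by (rule rel)
next
  case (inv h)
  then have "P (0 - h)" using assms H_0 relator_in_H by blast
  then show ?case using tensor_relators_subset inv by auto
next
  case (eng h1 h2)
  then have h: "h1 \<in> H" "h2 \<in> H" by (simp_all add: tensor_subgroup_def)
  then have "P (0 - h2)" using eng assms H_0 by blast
  then have "P (h1 - (0 - h2))" using eng h H_0 H_diff diff by blast
  then show ?case by simp
qed

lemma scale_closed:
  "\<lbrakk>b \<in> carrier S; c \<in> carrier F\<rbrakk> \<Longrightarrow> scale b c \<in> carrier F"
  using keys_frag_extend[of "\<lambda>(s, m). frag_of (b \<otimes>\<^bsub>S\<^esub> s, m)" c]
  by (fastforce simp: scale_def keys_frag_of)

lemma scale_frag_of [simp]: "scale b (frag_of (s, m)) = frag_of (b \<otimes>\<^bsub>S\<^esub> s, m)"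
  by (simp add: scale_def)

lemma scale_diff: "scale b (c - d) = scale b c - scale b d"
  by (simp add: scale_def frag_extend_diff)

lemma scale_add: "scale b (c + d) = scale b c + scale b d"
  by (simp add: scale_def frag_extend_add)

lemma scale_0 [simp]: "scale b 0 = 0"
  by (simp add: scale_def)

text \<open>Scaling acts on the left factor only and preserves each of the three kinds of relators.
  Hence \<open>H\<close> is stable and the action descends to cosets.\<close>

lemma scale_relator:
  assumes b: "b \<in> carrier S" and "c \<in> tensor_relators R S \<phi> M"
  shows "scale b c \<in> tensor_relators R S \<phi> M"
  using assms(2)
proof (cases rule: tensor_relatorE)
  case left
  then show ?thesis
    using b tensor_relatorI(1) by (simp add: scale_diff S.r_distr)
next
  case right
  then show ?thesis
    using b tensor_relatorI(2) by (simp add: scale_diff)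
next
  case (scalar s r m)
  then have "scale b c = frag_of ((b \<otimes>\<^bsub>S\<^esub> s) \<otimes>\<^bsub>S\<^esub> \<phi> r, m) - frag_of (b \<otimes>\<^bsub>S\<^esub> s, r \<odot>\<^bsub>M\<^esub> m)"
    using b phi_closed by (simp add: scale_diff S.m_assoc)
  then show ?thesis
    using b scalar tensor_relatorI(3) by simp
qed

lemma scale_H: "\<lbrakk>c \<in> H; b \<in> carrier S\<rbrakk> \<Longrightarrow> scale b c \<in> H"
proof (induction rule: H_induct)
  case zero
  then show ?case using H_0 by simp
next
  case (diff c d)
  then show ?case using H_diff by (simp add: scale_diff)
next
  case (relator c)
  then show ?case using relator_in_H scale_relator by blast
qed

lemma rcos_eq_iff:
  assumes "c \<in> carrier F" "d \<in> carrier F"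
  shows "H #>\<^bsub>F\<^esub> c = H #>\<^bsub>F\<^esub> d \<longleftrightarrow> c - d \<in> H"
proof
  assume "H #>\<^bsub>F\<^esub> c = H #>\<^bsub>F\<^esub> d"
  moreover have "c \<in> H #>\<^bsub>F\<^esub> c" using H_0 by (force simp: r_coset_def)
  ultimately obtain h where "h \<in> H" "c = h + d" by (auto simp: r_coset_def)
  then show "c - d \<in> H" by simp
next
  assume "c - d \<in> H"
  then have "c \<in> H #>\<^bsub>F\<^esub> d" by (force simp: r_coset_def)
  then show "H #>\<^bsub>F\<^esub> c = H #>\<^bsub>F\<^esub> d"
    using group.repr_independence[OF group_free_Abelian_group _ assms(2) subgroup_H] by metis
qed

lemma extend_scalars_simps:
  "carrier (extend_scalars R S \<phi> M) = (\<lambda>c. H #>\<^bsub>F\<^esub> c) ` carrier F"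
  "\<zero>\<^bsub>extend_scalars R S \<phi> M\<^esub> = H"
  "b \<odot>\<^bsub>extend_scalars R S \<phi> M\<^esub> U = (\<Union>c\<in>U. H #>\<^bsub>F\<^esub> scale b c)"
  by (auto simp: extend_scalars_def mk_module_def Let_def scale_def RCOSETS_def)

lemma H_coset_zero: "H #>\<^bsub>F\<^esub> 0 = H"
  by (simp add: r_coset_def)

lemma extend_scalars_smult:
  assumes "b \<in> carrier S" "c \<in> carrier F"
  shows "b \<odot>\<^bsub>extend_scalars R S \<phi> M\<^esub> (H #>\<^bsub>F\<^esub> c) = H #>\<^bsub>F\<^esub> scale b c"
proof -
  have "H #>\<^bsub>F\<^esub> scale b c' = H #>\<^bsub>F\<^esub> scale b c" if c': "c' \<in> H #>\<^bsub>F\<^esub> c" for c'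
  proof -
    obtain h where h: "h \<in> H" "c' = h + c" using c' by (auto simp: r_coset_def)
    then have "h \<in> carrier F" using subgroup.mem_carrier[OF subgroup_H] by blast
    then have "c' \<in> carrier F"
      using h assms keys_add[of h c] by auto
    then show ?thesis
      using rcos_eq_iff[OF scale_closed[OF assms(1) \<open>c' \<in> carrier F\<close>] scale_closed[OF assms]]
        scale_H[OF h(1) assms(1)] by (simp add: h(2) scale_add)
  qed
  moreover have "c \<in> H #>\<^bsub>F\<^esub> c" using H_0 by (force simp: r_coset_def)
  ultimately show ?thesis
    unfolding extend_scalars_simps by blast
qed

lemma scale_scale:
  assumes "a \<in> carrier S" "b \<in> carrier S" "c \<in> carrier F"
  shows "scale (a \<otimes>\<^bsub>S\<^esub> b) c = scale a (scale b c)"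
proof -
  have "Poly_Mapping.keys c \<subseteq> carrier S \<times> carrier M" using assms by simp
  then show ?thesis
    by (induction c rule: frag_induction) (use assms in \<open>auto simp: scale_diff S.m_assoc\<close>)
qed

lemma scale_one:
  assumes "c \<in> carrier F"
  shows "scale \<one>\<^bsub>S\<^esub> c = c"
proof -
  have "Poly_Mapping.keys c \<subseteq> carrier S \<times> carrier M" using assms by simp
  then show ?thesis
    by (induction c rule: frag_induction) (auto simp: scale_diff)
qed

lemma scalar_action_extend_scalars: "scalar_action S (extend_scalars R S \<phi> M)"
proof unfold_locales
  fix a b U assume "a \<in> carrier S" "b \<in> carrier S" "U \<in> carrier (extend_scalars R S \<phi> M)"
  then show "(a \<otimes>\<^bsub>S\<^esub> b) \<odot>\<^bsub>extend_scalars R S \<phi> M\<^esub> U =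
      a \<odot>\<^bsub>extend_scalars R S \<phi> M\<^esub> (b \<odot>\<^bsub>extend_scalars R S \<phi> M\<^esub> U)"
    unfolding extend_scalars_simps(1)
    by (auto simp del: carrier_free_Abelian_group_iff simp: extend_scalars_smult scale_scale scale_closed)
next
  fix a assume a: "a \<in> carrier S"
  then have "a \<odot>\<^bsub>extend_scalars R S \<phi> M\<^esub> (H #>\<^bsub>F\<^esub> 0) = H #>\<^bsub>F\<^esub> 0"
    by (subst extend_scalars_smult) auto
  then show "a \<odot>\<^bsub>extend_scalars R S \<phi> M\<^esub> \<zero>\<^bsub>extend_scalars R S \<phi> M\<^esub> = \<zero>\<^bsub>extend_scalars R S \<phi> M\<^esub>"
    by (simp add: extend_scalars_simps(2) H_coset_zero)
next
  have "(0 :: 'b \<times> 'c \<Rightarrow>\<^sub>0 int) \<in> carrier F" by simp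
  then show "\<zero>\<^bsub>extend_scalars R S \<phi> M\<^esub> \<in> carrier (extend_scalars R S \<phi> M)"
    unfolding extend_scalars_simps(1,2) using H_coset_zero by (metis imageI)
qed (auto simp del: carrier_free_Abelian_group_iff
      simp: extend_scalars_simps(1) extend_scalars_smult scale_one scale_closed)

lemma pure_mem: "\<lbrakk>s \<in> carrier S; m \<in> carrier M\<rbrakk> \<Longrightarrow> pure s m \<in> carrier (extend_scalars R S \<phi> M)"
  by (auto simp: extend_scalars_simps(1) pure_def)

lemma smult_pure:
  "\<lbrakk>b \<in> carrier S; s \<in> carrier S; m \<in> carrier M\<rbrakk>
     \<Longrightarrow> b \<odot>\<^bsub>extend_scalars R S \<phi> M\<^esub> pure s m = pure (b \<otimes>\<^bsub>S\<^esub> s) m"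
  unfolding pure_def by (subst extend_scalars_smult) auto

lemma pure_eq_zero_iff:
  assumes "s \<in> carrier S" "m \<in> carrier M"
  shows "pure s m = \<zero>\<^bsub>extend_scalars R S \<phi> M\<^esub> \<longleftrightarrow> frag_of (s, m) \<in> H"
  using rcos_eq_iff[of "frag_of (s, m)" 0] assms by (simp add: pure_def extend_scalars_simps H_coset_zero)

lemma frag_of_add_left:
  assumes "s \<in> carrier S" "s' \<in> carrier S" "m \<in> carrier M" "frag_of (s, m) \<in> H" "frag_of (s', m) \<in> H"
  shows "frag_of (s \<oplus>\<^bsub>S\<^esub> s', m) \<in> H"
proof -
  have "frag_of (s \<oplus>\<^bsub>S\<^esub> s', m) - frag_of (s, m) - frag_of (s', m) \<in> H"
    using assms by (intro relator_in_H tensor_relatorI)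
  from H_add[OF H_add[OF this assms(4)] assms(5)] show ?thesis by simp
qed

text \<open>The scalar \<open>r\<close> moves across the tensor sign and turns \<open>m\<close> into
  \<open>z\<close>. The equation \<open>z + z = z\<close> expresses that \<open>z\<close> acts as
  zero: right additivity then puts the tensor of \<open>s\<close> and \<open>z\<close> into
  \<open>H\<close>.\<close>

lemma frag_of_annihilated:
  assumes "s \<in> carrier S" "r \<in> carrier R" "m \<in> carrier M" "z \<in> carrier M" "r \<odot>\<^bsub>M\<^esub> m = z" "z \<oplus>\<^bsub>M\<^esub> z = z"
  shows "frag_of (s \<otimes>\<^bsub>S\<^esub> \<phi> r, m) \<in> H"
proof -
  have "frag_of (s, z \<oplus>\<^bsub>M\<^esub> z) - frag_of (s, z) - frag_of (s, z) \<in> H"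
    using assms(1,4) by (intro relator_in_H tensor_relatorI)
  from H_minus[OF this] have "frag_of (s, z) \<in> H" by (simp add: assms(6))
  moreover have "frag_of (s \<otimes>\<^bsub>S\<^esub> \<phi> r, m) - frag_of (s, z) \<in> H"
    using relator_in_H[OF tensor_relatorI(3)[OF assms(1-3)]] by (simp add: assms(5))
  ultimately show ?thesis using H_add by fastforce
qed

text \<open>Balanced maps are only required to satisfy the bilinearity relations modulo a subgroup, so that
  they may be given by formulas in representatives.\<close>

lemma balanced_map_mem:
  fixes \<psi> :: "'b \<Rightarrow> 'c \<Rightarrow> 'd::ab_group_add"
  assumes J: "0 \<in> J" "\<And>x y. \<lbrakk>x \<in> J; y \<in> J\<rbrakk> \<Longrightarrow> x - y \<in> J"
    and left: "\<And>s s' m. \<lbrakk>s \<in> carrier S; s' \<in> carrier S; m \<in> carrier M\<rbrakk>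
       \<Longrightarrow> \<psi> (s \<oplus>\<^bsub>S\<^esub> s') m - \<psi> s m - \<psi> s' m \<in> J"
    and right: "\<And>s m m'. \<lbrakk>s \<in> carrier S; m \<in> carrier M; m' \<in> carrier M\<rbrakk>
       \<Longrightarrow> \<psi> s (m \<oplus>\<^bsub>M\<^esub> m') - \<psi> s m - \<psi> s m' \<in> J"
    and scalar: "\<And>s r m. \<lbrakk>s \<in> carrier S; r \<in> carrier R; m \<in> carrier M\<rbrakk>
       \<Longrightarrow> \<psi> (s \<otimes>\<^bsub>S\<^esub> \<phi> r) m - \<psi> s (r \<odot>\<^bsub>M\<^esub> m) \<in> J"
    and mem: "frag_of (s, m) \<in> H"
  shows "\<psi> s m \<in> J"
proof -
  \<comment> \<open>The additive group of the target type as a record, to which the universal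
    property of the free abelian group applies.\<close>
  define D :: "'d monoid" where "D = \<lparr>carrier = UNIV, monoid.mult = (+), one = 0\<rparr>"
  have "comm_group D"
    by unfold_locales (auto simp: D_def add.assoc add.commute Units_def intro: exI[of _ "- x" for x])
  then obtain h where h: "h \<in> hom F D" and h_of: "\<And>x. x \<in> carrier S \<times> carrier M \<Longrightarrow> h (frag_of x) = case_prod \<psi> x"
    using comm_group.free_Abelian_group_universal[of D "case_prod \<psi>" "carrier S \<times> carrier M"]
    by (auto simp: D_def)
  have h_add: "h (c + d) = h c + h d" if "c \<in> carrier F" "d \<in> carrier F" for c d
    using h that hom_mult[OF h] by (simp add: D_def)
  have h_diff: "h (c - d) = h c - h d" if "c \<in> carrier F" "d \<in> carrier F" for c d
  proof -
    have "c - d \<in> carrier F" using that keys_diff[of c d] by auto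
    from h_add[OF this that(2)] show ?thesis by simp
  qed
  have h_diff2: "h (frag_of x - frag_of y) = case_prod \<psi> x - case_prod \<psi> y"
    if "x \<in> carrier S \<times> carrier M" "y \<in> carrier S \<times> carrier M" for x y
    using that by (subst h_diff) (simp_all add: h_of)
  have h_diff3: "h (frag_of x - frag_of y - frag_of z) = case_prod \<psi> x - case_prod \<psi> y - case_prod \<psi> z"
    if "x \<in> carrier S \<times> carrier M" "y \<in> carrier S \<times> carrier M" "z \<in> carrier S \<times> carrier M" for x y z
    using that keys_frag_diff2[of x y] by (subst h_diff) (auto simp: h_of h_diff2)
  \<comment> \<open>The extension \<open>h\<close> of \<open>\<psi>\<close> sends every relator into
    \<open>J\<close>, and \<open>J\<close> is closed under differences, so all of \<open>H\<close>
    lands in \<open>J\<close>.\<close>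
  have "h (frag_of (s, m)) \<in> J"
    using mem
  proof (induction rule: H_induct)
    case zero
    show ?case using h_diff[of 0 0] J by simp
  next
    case (diff c d)
    then show ?case using J subgroup.mem_carrier[OF subgroup_H] by (simp add: h_diff)
  next
    case (relator c)
    then show ?case
      by (cases rule: tensor_relatorE) (auto simp: h_diff2 h_diff3 left right scalar phi_closed M_add_closed M_smult_closed)
  qed
  moreover have "(s, m) \<in> carrier S \<times> carrier M"
    using H_carrier[OF mem] by (simp add: keys_frag_of)
  ultimately show ?thesis by (simp add: h_of)
qed

end

subsection \<open>The module of the example\<close>

lemma (in ideal) quot_module_simps:
  "carrier (quot_module R I) = (\<lambda>x. I +> x) ` carrier R"
  "\<zero>\<^bsub>quot_module R I\<^esub> = I"
  "\<lbrakk>x \<in> carrier R; y \<in> carrier R\<rbrakk> \<Longrightarrow> (I +> x) \<oplus>\<^bsub>quot_module R I\<^esub> (I +> y) = I +> (x \<oplus> y)"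
  by (auto simp: quot_module_def mk_module_def A_RCOSETS_def' a_rcos_sum)

lemma (in ideal) quot_module_smult:
  assumes "r \<in> carrier R" "x \<in> carrier R"
  shows "r \<odot>\<^bsub>quot_module R I\<^esub> (I +> x) = I +> (r \<otimes> x)"
proof -
  have "I +> (r \<otimes> x') = I +> (r \<otimes> x)" if "x' \<in> I +> x" for x'
  proof -
    have "\<exists>h\<in>I. x' = h \<oplus> x" using that by (auto simp: a_r_coset_def')
    then obtain h where h: "h \<in> I" "x' = h \<oplus> x" by blast
    then have "r \<otimes> x' = r \<otimes> h \<oplus> r \<otimes> x"
      using assms by (simp add: r_distr)
    moreover have "r \<otimes> h \<in> I" using assms h I_l_closed by blast
    ultimately have "r \<otimes> x' \<in> I +> (r \<otimes> x)"
      unfolding a_r_coset_def' by (metis UN_I singletonI)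
    then show ?thesis using assms a_repr_independence' m_closed by metis
  qed
  moreover have "x \<in> I +> x" using assms a_rcos_self by blast
  ultimately have "(\<Union>x'\<in>I +> x. I +> (r \<otimes> x')) = I +> (r \<otimes> x)"
    by blast
  then show ?thesis by (simp add: quot_module_def mk_module_def)
qed

lemma ring_R_simps [simp]:
  "carrier ring_R = UNIV" "r \<otimes>\<^bsub>ring_R\<^esub> s = r * s" "r \<oplus>\<^bsub>ring_R\<^esub> s = r + s"
  "\<one>\<^bsub>ring_R\<^esub> = 1" "\<zero>\<^bsub>ring_R\<^esub> = 0"
  by (simp_all add: ring_R_def ring_of_type_algebra_def)

lemma ring_A_simps [simp]:
  "carrier ring_A = UNIV" "r \<otimes>\<^bsub>ring_A\<^esub> s = r * s" "r \<oplus>\<^bsub>ring_A\<^esub> s = r + s"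
  "\<one>\<^bsub>ring_A\<^esub> = 1" "\<zero>\<^bsub>ring_A\<^esub> = 0"
  by (simp_all add: ring_A_def ring_of_type_algebra_def)

lemma cring_ring_R: "cring ring_R"
  unfolding ring_R_def by (rule cring_from_type_algebra)

lemma domain_ring_A: "domain ring_A"
proof -
  interpret cring ring_A unfolding ring_A_def by (rule cring_from_type_algebra)
  show ?thesis by unfold_locales auto
qed

lemma ring_A_pow [simp]: "a [^]\<^bsub>ring_A\<^esub> (n::nat) = a ^ n"
  by (induction n) (simp_all add: nat_pow_def mult.commute)

lemma ideal_ideal_F: "ideal ideal_F ring_R"
  unfolding ideal_F_def by (rule cring.cgenideal_ideal[OF cring_ring_R]) simp

lemma mem_ideal_F: "r \<in> ideal_F \<longleftrightarrow> poly_F dvd r"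
  by (auto simp: ideal_F_def cgenideal_def dvd_def mult.commute)

lemma cring_ring_RF: "cring ring_RF"
  unfolding ring_RF_def by (rule ideal.quotient_is_cring[OF ideal_ideal_F cring_ring_R])

lemma to_RF_hom: "to_RF \<in> ring_hom ring_R ring_RF"
  using ideal.rcos_ring_hom[OF ideal_ideal_F] by (simp add: to_RF_def[abs_def] ring_RF_def)

lemma carrier_ring_RF: "carrier ring_RF = range to_RF"
  by (auto simp: ring_RF_def FactRing_def A_RCOSETS_def' to_RF_def[abs_def])

lemma to_RF_carrier [simp]: "to_RF r \<in> carrier ring_RF"
  by (simp add: carrier_ring_RF)

lemma to_RF_mult [simp]: "to_RF r \<otimes>\<^bsub>ring_RF\<^esub> to_RF s = to_RF (r * s)"
  using ring_hom_mult[OF to_RF_hom, of r s] by simp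

lemma to_RF_add [simp]: "to_RF r \<oplus>\<^bsub>ring_RF\<^esub> to_RF s = to_RF (r + s)"
  using ring_hom_add[OF to_RF_hom, of r s] by simp

lemma to_RF_one: "\<one>\<^bsub>ring_RF\<^esub> = to_RF 1"
  by (rule ring_hom_one[OF to_RF_hom, simplified, symmetric])

lemma to_RF_zero: "\<zero>\<^bsub>ring_RF\<^esub> = to_RF 0"
  using ring_hom_zero[OF to_RF_hom cring.axioms(1)[OF cring_ring_R] cring.axioms(1)[OF cring_ring_RF]]
  by (simp add: eq_commute)

lemma to_RF_pow [simp]: "to_RF r [^]\<^bsub>ring_RF\<^esub> (n::nat) = to_RF (r ^ n)"
  by (induction n) (simp_all add: nat_pow_def to_RF_one mult.commute)

lemma to_RF_eq_iff: "to_RF r = to_RF s \<longleftrightarrow> poly_F dvd r - s"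
proof -
  interpret ideal ideal_F ring_R by (rule ideal_ideal_F)
  have mem: "r \<in> to_RF s \<longleftrightarrow> poly_F dvd r - s" for r s :: "'a txy"
  proof
    assume "r \<in> to_RF s"
    then show "poly_F dvd r - s" by (auto simp: to_RF_def a_r_coset_def' mem_ideal_F)
  next
    assume "poly_F dvd r - s"
    then have "r - s \<in> ideal_F" "r = (r - s) \<oplus>\<^bsub>ring_R\<^esub> s" by (simp_all add: mem_ideal_F)
    then show "r \<in> to_RF s" unfolding to_RF_def a_r_coset_def' by blast
  qed
  show ?thesis
    using mem[of r s] a_repr_independence'[of r s] a_rcos_self[of r] by (auto simp: to_RF_def)
qed

lemma to_RF_const_hom: "(\<lambda>a. to_RF (const_A a)) \<in> ring_hom ring_A ring_RF"
  by (rule ring_hom_memI) (simp_all add: const_A_def to_RF_one one_pCons)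

section \<open>Representatives and evaluation at the origin\<close>

text \<open>A chosen representative, compatible with the ring operations only up to multiples of
  \<open>poly_F\<close>; such errors are absorbed by the ideal.\<close>

definition lift_RF :: "'k::field txy set \<Rightarrow> 'k txy" where
  "lift_RF s = (SOME r. to_RF r = s)"

lemma to_RF_lift: "s \<in> carrier ring_RF \<Longrightarrow> to_RF (lift_RF s) = s"
  unfolding lift_RF_def carrier_ring_RF by (rule someI_ex) auto

definition ideal_xy :: "'k::field txy set set" where
  "ideal_xy = Idl\<^bsub>ring_RF\<^esub> {to_RF x_R, to_RF y_R}"

lemma module_MF_eq: "module_MF = quot_module ring_RF ideal_xy"
  by (simp add: module_MF_def ideal_xy_def)

lemma ideal_ideal_xy: "ideal ideal_xy ring_RF"
  unfolding ideal_xy_def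
  by (rule ring.genideal_ideal) (simp_all add: cring_ring_RF cring.axioms)

text \<open>Evaluation at \<open>x = y = 0\<close>, with values in \<open>k[t]\<close>.\<close>

definition origin :: "'k::field txy \<Rightarrow> 'k poly" where
  "origin r = coeff (coeff r 0) 0"

lemma origin_simps [simp]:
  "origin (r + s) = origin r + origin s" "origin (r - s) = origin r - origin s"
  "origin (- r) = - origin r"
  "origin (r * s) = origin r * origin s" "origin 0 = 0" "origin 1 = 1"
  "origin x_R = 0" "origin y_R = 0"
  by (simp_all add: origin_def coeff_mult x_R_def y_R_def)

lemma origin_poly_F: "poly_F dvd r \<Longrightarrow> origin r = 0"
  by (auto simp: dvd_def poly_F_def)

text \<open>By minimality, since the right side is an ideal containing both generators. This makes
  evaluation at the origin well defined on \<open>M_F\<close>.\<close>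

lemma ideal_xy_subset: "ideal_xy \<subseteq> to_RF ` {r. origin r = 0}"
  unfolding ideal_xy_def
proof (rule ring.genideal_minimal)
  interpret cring ring_RF by (rule cring_ring_RF)
  show "ring ring_RF" ..
  let ?K = "to_RF ` {r :: 'a txy. origin r = 0}"
  have "0 \<in> {r :: 'a txy. origin r = 0}" by simp
  then have ne: "?K \<noteq> {}" by blast
  show "ideal ?K ring_RF"
  proof (rule idealI[OF ring_axioms])
    show "subgroup ?K (add_monoid ring_RF)"
    proof (rule add.subgroupI)
      show "\<ominus>\<^bsub>ring_RF\<^esub> s \<in> ?K" if s: "s \<in> ?K" for s
      proof -
        obtain r where r: "origin r = 0" "s = to_RF r" using s by auto
        have "\<ominus>\<^bsub>ring_RF\<^esub> s = to_RF (- r)"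
          unfolding r by (intro minus_equality) (simp_all add: to_RF_zero)
        then show ?thesis using r by auto
      qed
      show "s \<oplus>\<^bsub>ring_RF\<^esub> s' \<in> ?K" if "s \<in> ?K" "s' \<in> ?K" for s s'
        using that by auto
    qed (use ne in auto)
  qed (auto simp: carrier_ring_RF)
  show "{to_RF x_R, to_RF y_R} \<subseteq> ?K" by auto
qed

definition class_MF :: "'k::field txy \<Rightarrow> 'k txy set set" where
  "class_MF r = ideal_xy +>\<^bsub>ring_RF\<^esub> to_RF r"

definition value_MF :: "'k::field txy set set \<Rightarrow> 'k poly" where
  "value_MF m = origin (SOME r. class_MF r = m)"

lemma origin_eq_of_class_MF_eq:
  assumes "class_MF r = class_MF s"
  shows "origin r = origin s"
proof -
  interpret ideal ideal_xy ring_RF by (rule ideal_ideal_xy)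
  have "to_RF r \<in> ideal_xy +>\<^bsub>ring_RF\<^esub> to_RF s"
    using assms a_rcos_self[of "to_RF r"] by (simp add: class_MF_def)
  then obtain h where h: "h \<in> ideal_xy" "to_RF r = h \<oplus>\<^bsub>ring_RF\<^esub> to_RF s"
    by (auto simp: a_r_coset_def')
  obtain h0 where h0: "origin h0 = 0" "h = to_RF h0"
    using subsetD[OF ideal_xy_subset h(1)] by blast
  have "to_RF r = to_RF (h0 + s)"
    unfolding h(2) h0(2) by (rule to_RF_add)
  then have "origin (r - (h0 + s)) = 0"
    unfolding to_RF_eq_iff by (rule origin_poly_F)
  then show ?thesis by (simp add: h0(1))
qed

lemma value_class_MF [simp]: "value_MF (class_MF r) = origin r"
  unfolding value_MF_def by (rule someI2[of _ r], rule refl, erule origin_eq_of_class_MF_eq)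

lemma module_MF_simps [simp]:
  "carrier module_MF = range class_MF"
  "\<zero>\<^bsub>module_MF\<^esub> = class_MF 0"
  "class_MF r \<oplus>\<^bsub>module_MF\<^esub> class_MF s = class_MF (r + s)"
  "to_RF r \<odot>\<^bsub>module_MF\<^esub> class_MF s = class_MF (r * s)"
proof -
  interpret ideal ideal_xy ring_RF by (rule ideal_ideal_xy)
  show "carrier module_MF = range class_MF"
    by (auto simp: module_MF_eq quot_module_simps carrier_ring_RF class_MF_def)
  show "\<zero>\<^bsub>module_MF\<^esub> = class_MF 0"
    by (simp add: module_MF_eq quot_module_simps class_MF_def a_rcos_const flip: to_RF_zero)
  show "class_MF r \<oplus>\<^bsub>module_MF\<^esub> class_MF s = class_MF (r + s)"
    by (simp add: module_MF_eq quot_module_simps class_MF_def)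
  show "to_RF r \<odot>\<^bsub>module_MF\<^esub> class_MF s = class_MF (r * s)"
    by (simp add: module_MF_eq quot_module_smult class_MF_def)
qed

lemma class_MF_eq_zero: "r \<in> {x_R, y_R} \<Longrightarrow> class_MF r = class_MF 0"
proof -
  assume r: "r \<in> {x_R, y_R}"
  interpret R: ring ring_RF using cring_ring_RF by (rule cring.axioms)
  interpret ideal ideal_xy ring_RF by (rule ideal_ideal_xy)
  have "to_RF r \<in> ideal_xy"
    using r R.genideal_self[of "{to_RF x_R, to_RF y_R}"] by (auto simp: ideal_xy_def)
  then have "class_MF r = \<zero>\<^bsub>module_MF\<^esub>"
    by (simp add: class_MF_def a_rcos_const module_MF_eq quot_module_simps del: module_MF_simps)
  then show ?thesis by simp
qed

section \<open>Elementary tensors and the ideal \<open>(F, x^q, y^q)\<close>\<close>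

lemma const_A_simps:
  "const_A (a + b) = const_A a + const_A b" "const_A (a - b) = const_A a - const_A b"
  "const_A (a * b) = const_A a * const_A b" "const_A 1 = 1" "const_A (a ^ n) = const_A a ^ n"
  by (simp_all add: const_A_def one_pCons poly_const_pow)

lemma decompose_xy: "\<exists>u v. r = const_A (origin r) + x_R * u + y_R * v"
proof -
  obtain f g where r: "r = pCons f g" by (metis pCons_cases)
  obtain a b where f: "f = pCons a b" by (metis pCons_cases)
  have "r = const_A (origin r) + x_R * [:b:] + y_R * g"
    by (simp add: r f origin_def const_A_def x_R_def y_R_def)
  then show ?thesis by blast
qed

text \<open>Write \<open>r = c + x u + y v\<close> with \<open>c\<close> in \<open>k[t]\<close>. By
  additivity of the \<open>q\<close>-th power, \<open>r^q - c^q = x^q u^q + y^q v^q\<close>.\<close>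

lemma frobenius_mod_powers:
  fixes r :: "'k::field txy"
  assumes "Factorial_Ring.prime CHAR('k)" "q = CHAR('k) ^ e"
  shows "s * (r ^ q - const_A (origin r) ^ q) \<in> katzman_ideal poly_F x_R y_R q"
proof -
  obtain u v where r: "r = const_A (origin r) + x_R * u + y_R * v"
    using decompose_xy by blast
  have "(b + c) ^ q = b ^ q + c ^ q" for b c :: "'k txy"
    by (rule freshmans_dream') (use assms in simp_all)
  then have "r ^ q = const_A (origin r) ^ q + (x_R * u) ^ q + (y_R * v) ^ q"
    by (subst r) simp
  then have "s * (r ^ q - const_A (origin r) ^ q) = (s * u ^ q) * x_R ^ q + (s * v ^ q) * y_R ^ q"
    by (simp add: power_mult_distrib algebra_simps)
  then show ?thesis using katzman_ideal_powers by metis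
qed

interpretation peskine: tensor ring_RF ring_RF "\<lambda>r. r [^]\<^bsub>ring_RF\<^esub> (q::nat)" module_MF for q
proof -
  interpret cring ring_RF by (rule cring_ring_RF)
  show "tensor ring_RF ring_RF (\<lambda>r. r [^]\<^bsub>ring_RF\<^esub> q) module_MF"
    by unfold_locales (auto simp: carrier_ring_RF)
qed

text \<open>The assignment of \<open>s m^q\<close> to the tensor of \<open>s\<close> and
  \<open>m\<close> is balanced modulo \<open>(F, x^q, y^q)\<close>, where \<open>m\<close> stands
  for its value in \<open>k[t]\<close>. A tensor that vanishes must therefore have its image in this
  ideal.\<close>

lemma pure_zero_imp_mem:
  fixes r :: "'k::field txy"
  assumes char: "Factorial_Ring.prime CHAR('k)" and q: "q = CHAR('k) ^ e"
    and zero: "frag_of (to_RF r, class_MF 1) \<in>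
      tensor_subgroup ring_RF ring_RF (\<lambda>r. r [^]\<^bsub>ring_RF\<^esub> q) module_MF"
  shows "r \<in> katzman_ideal poly_F x_R y_R q"
proof -
  let ?J = "katzman_ideal (poly_F :: 'k txy) x_R y_R q"
  define \<psi> where "\<psi> s m = lift_RF s * const_A (value_MF m) ^ q" for s :: "'k txy set" and m
  have lift_mod: "(lift_RF (to_RF r) - r) * c \<in> ?J" for r c
    using to_RF_lift[of "to_RF r"] by (intro katzman_ideal_f) (simp add: to_RF_eq_iff dvd_mult2)
  have dream: "(b + c) ^ q = b ^ q + c ^ q" for b c :: "'k txy"
    by (rule freshmans_dream') (use char q in simp_all)
  have "\<psi> (to_RF r) (class_MF 1) \<in> ?J"
  proof (rule peskine.balanced_map_mem[OF _ _ _ _ _ zero])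
    fix s s' :: "'k txy set" and m
    assume s: "s \<in> carrier ring_RF" "s' \<in> carrier ring_RF"
    define l l' where "l = lift_RF s" "l' = lift_RF s'"
    have "s \<oplus>\<^bsub>ring_RF\<^esub> s' = to_RF (l + l')"
      using s by (simp add: l_l'_def to_RF_lift flip: to_RF_add)
    then have "\<psi> (s \<oplus>\<^bsub>ring_RF\<^esub> s') m - \<psi> s m - \<psi> s' m =
        (lift_RF (to_RF (l + l')) - (l + l')) * const_A (value_MF m) ^ q"
      by (simp add: \<psi>_def l_l'_def algebra_simps)
    then show "\<psi> (s \<oplus>\<^bsub>ring_RF\<^esub> s') m - \<psi> s m - \<psi> s' m \<in> ?J"
      using lift_mod by metis
  next
    fix s :: "'k txy set" and m m' :: "'k txy set set"
    assume "m \<in> carrier module_MF" "m' \<in> carrier module_MF"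
    then show "\<psi> s (m \<oplus>\<^bsub>module_MF\<^esub> m') - \<psi> s m - \<psi> s m' \<in> ?J"
      by (auto simp: \<psi>_def const_A_simps dream algebra_simps)
  next
    fix s r :: "'k txy set" and m :: "'k txy set set"
    assume s: "s \<in> carrier ring_RF" "r \<in> carrier ring_RF" and m: "m \<in> carrier module_MF"
    define l l' where "l = lift_RF s" "l' = lift_RF r"
    note l = this
    define c where "c = const_A (value_MF m) ^ q"
    have 1: "s \<otimes>\<^bsub>ring_RF\<^esub> r [^]\<^bsub>ring_RF\<^esub> q = to_RF (l * l' ^ q)"
      using s by (simp add: l to_RF_lift flip: to_RF_mult to_RF_pow)
    have "value_MF (r \<odot>\<^bsub>module_MF\<^esub> m) = value_MF (to_RF l' \<odot>\<^bsub>module_MF\<^esub> m)"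
      using s by (simp add: l to_RF_lift)
    also have "\<dots> = origin l' * value_MF m" using m by auto
    finally have 2: "value_MF (r \<odot>\<^bsub>module_MF\<^esub> m) = origin l' * value_MF m" .
    \<comment> \<open>There are two errors: one from the choice of a representative, a multiple of
      \<open>F\<close>, and one from replacing \<open>l'^q\<close> by the \<open>q\<close>-th power
      of its value at the origin.\<close>
    have "\<psi> (s \<otimes>\<^bsub>ring_RF\<^esub> r [^]\<^bsub>ring_RF\<^esub> q) m - \<psi> s (r \<odot>\<^bsub>module_MF\<^esub> m) =
       (lift_RF (to_RF (l * l' ^ q)) - l * l' ^ q) * c + (l * c) * (l' ^ q - const_A (origin l') ^ q)"
      unfolding \<psi>_def 1 2 by (simp add: l c_def const_A_simps power_mult_distrib algebra_simps)
    then show "\<psi> (s \<otimes>\<^bsub>ring_RF\<^esub> r [^]\<^bsub>ring_RF\<^esub> q) m - \<psi> s (r \<odot>\<^bsub>module_MF\<^esub> m) \<in> ?J"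
      using katzman_ideal_add[OF lift_mod frobenius_mod_powers[OF char q]] by simp
  qed (simp_all add: katzman_ideal_diff)
  \<comment> \<open>The class of 1 has value 1, so \<open>\<psi>\<close> returns just the chosen
    representative of \<open>r\<close>.\<close>
  then have "lift_RF (to_RF r) \<in> ?J" by (simp add: \<psi>_def const_A_simps)
  from katzman_ideal_diff[OF this lift_mod[of r 1]] show ?thesis by simp
qed

text \<open>The multiple of \<open>F\<close> dies in \<open>R_F\<close>. The powers
  \<open>x^q\<close> and \<open>y^q\<close> cross the tensor sign as \<open>x\<close> and
  \<open>y\<close>, which kill the generator of \<open>M_F\<close>.\<close>

lemma mem_imp_pure_zero:
  assumes "r \<in> katzman_ideal poly_F x_R y_R q"
  shows "frag_of (to_RF r, class_MF 1) \<in>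
      tensor_subgroup ring_RF ring_RF (\<lambda>r. r [^]\<^bsub>ring_RF\<^esub> q) module_MF"
proof -
  obtain \<alpha> \<beta> \<gamma> where "r = \<alpha> * poly_F + \<beta> * x_R ^ q + \<gamma> * y_R ^ q"
    using assms by (auto simp: katzman_ideal_iff)
  then have "to_RF r = to_RF (\<beta> * x_R ^ q + \<gamma> * y_R ^ q)"
    by (simp add: to_RF_eq_iff)
  then have r: "to_RF r = to_RF \<beta> \<otimes>\<^bsub>ring_RF\<^esub> to_RF x_R [^]\<^bsub>ring_RF\<^esub> q
      \<oplus>\<^bsub>ring_RF\<^esub> to_RF \<gamma> \<otimes>\<^bsub>ring_RF\<^esub> to_RF y_R [^]\<^bsub>ring_RF\<^esub> q"
    by simp
  show ?thesis
    unfolding r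
    by (intro peskine.frag_of_add_left peskine.frag_of_annihilated[where z = "class_MF 0"])
      (simp_all add: class_MF_eq_zero)
qed

section \<open>Torsion that no single localization removes\<close>

theorem theorem12:
  fixes p :: nat
  assumes "CHAR('k::field) = p" and "p > 0"
  shows "\<not> finite_torsion (ring_A :: 'k poly ring) {0<..}
           (\<lambda>e. restrict_scalars (\<lambda>a. to_RF (const_A a)) (peskine_szpiro p e ring_RF module_MF))"
proof
  assume "finite_torsion (ring_A :: 'k poly ring) {0<..}
           (\<lambda>e. restrict_scalars (\<lambda>a. to_RF (const_A a)) (peskine_szpiro p e ring_RF module_MF))"
  then obtain a :: "'k poly" where a: "a \<noteq> 0" and tf: "\<And>e. e > 0 \<Longrightarrow>
      torsion_free (loc_ring ring_A (powers ring_A a)) (loc_module ring_A (powers ring_A a)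
        (restrict_scalars (\<lambda>a. to_RF (const_A a)) (peskine_szpiro p e ring_RF module_MF)))"
    by (auto simp: finite_torsion_def)
  have char: "Factorial_Ring.prime CHAR('k)"
    using assms by (intro prime_CHAR_semidom) simp
  then have "p > 1" using assms prime_gt_1_nat by blast
  \<comment> \<open>Since \<open>p^e >= 2^e > e\<close>, this choice gives
    \<open>deg a + 2 < q\<close>, where 2 is the degree of \<open>t^2 - t\<close>.\<close>
  define e where "e = degree a + 2"
  define q where "q = p ^ e"
  have "e < 2 ^ e" by (rule less_exp)
  also have "(2::nat) ^ e \<le> q" unfolding q_def using \<open>p > 1\<close> by (intro power_mono) auto
  finally have q: "degree a + 2 < q" by (simp add: e_def)
  define N where "N = peskine_szpiro p e ring_RF (module_MF :: ('k txy set, _) module)"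
  have N: "N = extend_scalars ring_RF ring_RF (\<lambda>r. r [^]\<^bsub>ring_RF\<^esub> q) module_MF"
    by (simp add: N_def peskine_szpiro_def q_def)
  define M where "M = restrict_scalars (\<lambda>a. to_RF (const_A a)) N"
  have M: "carrier M = carrier N" "\<zero>\<^bsub>M\<^esub> = \<zero>\<^bsub>N\<^esub>" "c \<odot>\<^bsub>M\<^esub> m = to_RF (const_A c) \<odot>\<^bsub>N\<^esub> m" for c m
    by (simp_all add: M_def restrict_scalars_def mk_module_def)
  define w :: "'k txy" where "w = x_R ^ 2 * y_R ^ (q - 1)"
  define z where "z = peskine.pure q (to_RF w) (class_MF 1)"
  \<comment> \<open>Annihilation of the tensor of \<open>w\<close> and 1 becomes an ideal membership
    in \<open>R\<close>, where both halves of the argument about \<open>w\<close> live.\<close>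
  have zero_iff: "c \<odot>\<^bsub>M\<^esub> z = \<zero>\<^bsub>M\<^esub> \<longleftrightarrow> const_A c * w \<in> katzman_ideal poly_F x_R y_R q" for c
  proof -
    have "c \<odot>\<^bsub>M\<^esub> z = peskine.pure q (to_RF (const_A c * w)) (class_MF 1)"
      unfolding M z_def N by (subst peskine.smult_pure) simp_all
    then have "c \<odot>\<^bsub>M\<^esub> z = \<zero>\<^bsub>M\<^esub> \<longleftrightarrow> frag_of (to_RF (const_A c * w), class_MF 1) \<in>
        tensor_subgroup ring_RF ring_RF (\<lambda>r. r [^]\<^bsub>ring_RF\<^esub> q) module_MF"
      unfolding M(2) N by (simp add: peskine.pure_eq_zero_iff)
    then show ?thesis
      using mem_imp_pure_zero pure_zero_imp_mem[OF char, of q e] by (auto simp: q_def assms)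
  qed
  \<comment> \<open>The nonzero annihilator of \<open>w\<close> found by the recursion.\<close>
  define b :: "'k poly" where "b = [:0, 1:] ^ (q - 1) - 1"
  have "b \<noteq> 0"
  proof
    assume "b = 0"
    \<comment> \<open>At \<open>t = 0\<close> the power of \<open>t\<close> vanishes because
      \<open>q - 1 > 0\<close>, while 1 does not.\<close>
    then have "poly ([:0, 1:] ^ (q - 1)) (0::'k) = poly 1 0" by (simp add: b_def)
    then show False using q by (simp add: power_0_left)
  qed
  moreover have "b \<odot>\<^bsub>M\<^esub> z = \<zero>\<^bsub>M\<^esub>"
    using four_lines_torsion[of q "t_R :: 'k txy" x_R y_R] q
    by (simp add: zero_iff w_def b_def const_A_simps poly_F_def t_R_def)
  moreover have "scalar_action ring_A M"
    unfolding M_def N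
    by (rule scalar_action_restrict_scalars[OF peskine.scalar_action_extend_scalars _ to_RF_const_hom])
      (rule domain.axioms[OF domain_ring_A])
  moreover have "z \<in> carrier M"
    unfolding M z_def N by (intro peskine.pure_mem) simp_all
  moreover have "torsion_free (loc_ring ring_A (powers ring_A a)) (loc_module ring_A (powers ring_A a) M)"
    using tf[of e] by (simp add: M_def N_def e_def)
  ultimately obtain n :: nat where "a ^ n \<odot>\<^bsub>M\<^esub> z = \<zero>\<^bsub>M\<^esub>"
    using torsion_free_localizationD[OF _ domain_ring_A, of M a b z] a by auto
  then have "[:[:a ^ n:]:] * w \<in> katzman_ideal poly_F x_R y_R q"
    by (simp only: zero_iff const_A_def)
  then have "([:0, 1:] ^ q - [:0, 1:]) dvd a ^ n * ([:0, 1:] ^ 2 - [:0, 1:])"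
    unfolding w_def poly_F_def t_R_def const_A_def x_R_def y_R_def
    by (intro four_lines_annihilator) (use q in auto)
  moreover have "([:0, 1:] ^ 2 - [:0, 1:] :: 'k poly) = [:0, - 1, 1:]"
    by (simp add: power2_eq_square)
  ultimately show False
    using not_dvd_power_mult[OF char, of q e a "[:0, - 1, 1:]" n] a q
    by (simp add: q_def assms e_def)
qed

end
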